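(* Let $f\in C^1(\mathbb R)$ and let $-\infty<a_-<a_0<a_+<+\infty$ be such that $f(a_\pm)=f(a_0)=0$, $f'(a_\pm)>0$, $f>0$ in $(a_-,a_0)$ and $f<0$ in $(a_0,a_+)$. Let $\alpha$ be a constant satisfying $$\alpha\in(a_-,a_0),\qquad \int_\alpha^{a_+} f(z)\,dz<0.$$ Then the strongly irreversible Allen–Cahn equation $\partial_t u=\big(\partial_x^2u-f(u)\big)_+$ admits a traveling wave solution $u(x,t)=\phi(x-ct)$ for some $c\in\mathbb R$. More precisely, there exists $c\in\mathbb R$ such that the profile equation $$-c\phi'=\big(\phi''-f(\phi)\big)_+\quad\text{in }\mathbb R$$ possesses a solution $\phi$ satisfying $$\lim_{\xi\to-\infty}\phi(\xi)=\alpha,\quad \lim_{\xi\to+\infty}\phi(\xi)=a_+,\quad \phi'\ge0\ \text{in }\mathbb R,\quad \lim_{\xi\to\pm\infty}\phi'(\xi)=0.$$ Moreover, the following hold for some constants $C_1,C_2>0$ depending only on $\alpha$ and $f$: (i) $\phi\in W^{2,\infty}(\mathbb R)$, $\phi'\in L^2(\mathbb R)$, and $\phi$ solves $-c\phi'-\phi''+\partial I_{[\alpha,+\infty)}(\phi)+f(\phi)\ni0$ in $\mathbb R$; (ii) $\alpha\le\phi<a_+$ and $0\le\phi'\le C_1$ in $\mathbb R$, and $-C_2\le c<0$; (iii) if $\phi(s)>\alpha$ at $s\in\mathbb R$, then $\phi'(s)>0$. Furthermore, there exists $s_*\in\mathbb R$ such that $$\phi(s)=\alpha\ \text{ on }(-\infty,s_*],\qquad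 \phi(s)>\alpha\ \text{ in }(s_*,+\infty).$$ In particular, $\phi\in C^2((s_*,+\infty))$, $\phi'>0$ in $(s_*,+\infty)$, and $\phi$ solves $-\phi''+f(\phi)=c\phi'$ in $(s_*,+\infty)$.
   Context: $(s)_+=\max\{s,0\}$. The set-valued map $\partial I_{[\alpha,+\infty)}$ is the subdifferential of the indicator function of $[\alpha,+\infty)$: $\partial I_{[\alpha,+\infty)}(s)=\{0\}$ if $s>\alpha$, $=(-\infty,0]$ if $s=\alpha$, $=\emptyset$ if $s<\alpha$. Since $\phi\in W^{2,\infty}(\mathbb R)$ need not be $C^2$, the profile equation and the inclusion on $\mathbb R$ are understood to hold almost everywhere. *)

theory Defs
  imports "HOL-Analysis.Analysis"
begin

text \<open>Sobolev spaces of functions on the real line.\<close>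

definition test_function :: "(real \<Rightarrow> real) \<Rightarrow> bool" where
  "test_function \<psi> \<longleftrightarrow>
     (\<forall>n. (deriv ^^ n) \<psi> differentiable_on UNIV) \<and> compact (closure {x. \<psi> x \<noteq> 0})"

definition L1_loc :: "(real \<Rightarrow> real) \<Rightarrow> bool" where
  "L1_loc u \<longleftrightarrow> (\<forall>K. compact K \<longrightarrow> set_integrable lebesgue K u)"

definition L2 :: "(real \<Rightarrow> real) \<Rightarrow> bool" where
  "L2 u \<longleftrightarrow> u \<in> borel_measurable lebesgue \<and> integrable lebesgue (\<lambda>x. (u x)\<^sup>2)"

definition L_infty :: "(real \<Rightarrow> real) \<Rightarrow> bool" where
  "L_infty u \<longleftrightarrow> u \<in> borel_measurable lebesgue \<and> (\<exists>B. AE x in lebesgue. \<bar>u x\<bar> \<le> B)"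

definition weak_derivative :: "nat \<Rightarrow> (real \<Rightarrow> real) \<Rightarrow> (real \<Rightarrow> real) \<Rightarrow> bool" where
  "weak_derivative n u v \<longleftrightarrow> L1_loc u \<and> L1_loc v \<and>
     (\<forall>\<psi>. test_function \<psi> \<longrightarrow>
        (LINT x|lebesgue. u x * (deriv ^^ n) \<psi> x) = (-1) ^ n * (LINT x|lebesgue. v x * \<psi> x))"

definition W_infty :: "nat \<Rightarrow> (real \<Rightarrow> real) \<Rightarrow> bool" where
  "W_infty k u \<longleftrightarrow> L_infty u \<and> (\<forall>n\<in>{1..k}. \<exists>v. L_infty v \<and> weak_derivative n u v)"

text \<open>The indicator function in the sense of convex analysis, and the subdifferential of a
  proper function.\<close>

definition convex_indicator :: "real set \<Rightarrow> real \<Rightarrow> ereal" where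
  "convex_indicator K s = (if s \<in> K then 0 else \<infinity>)"

definition subdifferential :: "(real \<Rightarrow> ereal) \<Rightarrow> real \<Rightarrow> real set" where
  "subdifferential F s = {\<eta>. F s \<noteq> \<infinity> \<and> (\<forall>v. F s + ereal (\<eta> * (v - s)) \<le> F v)}"

lemma subdifferential_convex_indicator:
  "subdifferential (convex_indicator {\<alpha>..}) s =
     (if s > \<alpha> then {0} else if s = \<alpha> then {..0} else {})"
proof -
  have "\<eta> = 0" if "s > \<alpha>" and *: "\<forall>v\<ge>\<alpha>. \<eta> * (v - s) \<le> 0" for \<eta>
    using *[rule_format, of \<alpha>] *[rule_format, of "s + 1"] that(1)
    by (auto simp: mult_le_0_iff)
  moreover have "\<eta> \<le> 0" if "\<forall>v\<ge>\<alpha>. \<eta> * (v - \<alpha>) \<le> 0" for \<eta>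
    using that[rule_format, of "\<alpha> + 1"] by simp
  moreover have "subdifferential (convex_indicator {\<alpha>..}) s =
      {\<eta>. \<alpha> \<le> s \<and> (\<forall>v\<ge>\<alpha>. \<eta> * (v - s) \<le> 0)}"
    by (auto simp: subdifferential_def convex_indicator_def zero_ereal_def)
  ultimately show ?thesis
    by (auto simp: mult_le_0_iff)
qed

text \<open>Solutions that are $W^{2,\infty}$ in space are identified with their $C^1$
  representatives: first derivatives are required to exist everywhere, second derivatives
  almost everywhere.  For a $W^{2,\infty}$ function the latter agree almost everywhere with the
  weak second derivative.  These predicates do not include Sobolev regularity themselves.\<close>

definition solves_irreversible_AC :: "(real \<Rightarrow> real) \<Rightarrow> (real \<Rightarrow> real \<Rightarrow> real) \<Rightarrow> bool" where
  "solves_irreversible_AC f u \<longleftrightarrow>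
     (\<forall>x t. (\<lambda>y. u y t) differentiable (at x) \<and> u x differentiable (at t)) \<and>
     (AE (x, t) in lebesgue. deriv (\<lambda>y. u y t) differentiable (at x) \<and>
        deriv (u x) t = max (deriv (deriv (\<lambda>y. u y t)) x - f (u x t)) 0)"

definition solves_profile :: "(real \<Rightarrow> real) \<Rightarrow> real \<Rightarrow> (real \<Rightarrow> real) \<Rightarrow> bool" where
  "solves_profile f c \<phi> \<longleftrightarrow>
     (\<forall>x. \<phi> differentiable (at x)) \<and>
     (AE x in lebesgue. deriv \<phi> differentiable (at x) \<and>
        - c * deriv \<phi> x = max (deriv (deriv \<phi>) x - f (\<phi> x)) 0)"

definition solves_obstacle_inclusion ::
    "(real \<Rightarrow> real) \<Rightarrow> real \<Rightarrow> real \<Rightarrow> (real \<Rightarrow> real) \<Rightarrow> bool" where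
  "solves_obstacle_inclusion f \<alpha> c \<phi> \<longleftrightarrow>
     (\<forall>x. \<phi> differentiable (at x)) \<and>
     (AE x in lebesgue. deriv \<phi> differentiable (at x) \<and>
        0 \<in> (\<lambda>\<eta>. - c * deriv \<phi> x - deriv (deriv \<phi>) x + \<eta> + f (\<phi> x)) `
              subdifferential (convex_indicator {\<alpha>..}) (\<phi> x))"

end

theory Submission
  imports Defs
begin

text \<open>Put \<open>k = - c\<close> and start the ODE \<open>u'' = k u' + f u\<close> from \<open>u = \<alpha>\<close>, \<open>u' = 0\<close> at time 0.
  If \<open>k = 0\<close>, conservation of \<open>u'\<^sup>2 / 2 - \<integral> f\<close> prevents \<open>u\<close> from reaching \<open>a\<^sub>+\<close>; if \<open>k\<close> is
  large, \<open>u' \<ge> u - \<alpha>\<close>, so \<open>u\<close> never turns back.  Turning back before \<open>a\<^sub>+\<close> and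
  overshooting \<open>a\<^sub>+\<close> are disjoint open conditions on \<open>k\<close>, so by connectedness some \<open>k\<close>
  satisfies neither, and its trajectory increases to \<open>a\<^sub>+\<close>.  Extended by \<open>\<alpha>\<close> to the left, it is the
  profile: there \<open>f \<alpha> > 0\<close> makes the positive part vanish, and to the right the
  positive part is \<open>k u' \<ge> 0\<close>.\<close>

section \<open>Globally Lipschitz differential equations with a parameter\<close>

text \<open>Two obstacles shape the argument. First, \<open>f\<close> is only locally Lipschitz and
  a trajectory may leave the interval from \<alpha> to \<open>a_plus\<close>. Shooting is therefore
  done for a globally Lipschitz \<open>g\<close> that equals \<open>f\<close> on that interval; the
  profile never leaves it and does not see the change. Second, a trajectory may turn back and later
  still pass \<open>a_plus\<close>, or pass it and turn back afterwards. To be disjoint, the two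
  alternatives must record what happened on the way. They do so by strict inequalities over compact
  time intervals, which are open in the speed without any continuity of hitting times. Closing the
  gap between the alternatives means excluding tangencies, where the velocity only touches zero. At
  an interior minimum of a nonnegative velocity the acceleration vanishes too, so the trajectory
  would sit at an equilibrium, and by uniqueness it would always have been there; but \<alpha> is no
  equilibrium. The speeds range over \<open>{0..L + 1}\<close>, where \<open>L\<close> is the
  Lipschitz constant of \<open>g\<close>.\<close>

lemma scaled_integral_has_vector_derivative:
  fixes H :: "real \<Rightarrow> 'a::banach"
  assumes "continuous_on UNIV H"
  shows "((\<lambda>t. t *\<^sub>R integral {0..1} (\<lambda>\<sigma>. H (t * \<sigma>))) has_vector_derivative H t) (at t)"
proof -
  \<comment> \<open>The scaled form is the antiderivative of \<open>H\<close> that vanishes at 0. It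
    treats both signs of \<open>t\<close> at once, and its fixed domain \<open>{0..1}\<close>
    reduces continuity in a parameter to integrals over one compact interval. The margin 1 puts
    \<open>t\<close> in the interior of the auxiliary interval.\<close>
  define n where "n = \<bar>t\<bar> + 1"
  obtain P where P: "\<And>x. x \<in> {-n..n} \<Longrightarrow> (P has_vector_derivative H x) (at x within {-n..n})"
    using antiderivative_continuous[of "-n" n H] assms continuous_on_subset by blast
  have eq: "s *\<^sub>R integral {0..1} (\<lambda>\<sigma>. H (s * \<sigma>)) = P s - P 0" if s: "s \<in> {-n..n}" for s
  proof -
    have rng: "s * \<sigma> \<in> {-n..n}" if "\<sigma> \<in> {0..1}" for \<sigma>
    proof -
      have "\<bar>s * \<sigma>\<bar> \<le> \<bar>s\<bar>"
        using that by (simp add: abs_mult mult_left_le)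
      then show ?thesis using s by auto
    qed
    have "((\<lambda>\<sigma>. P (s * \<sigma>)) has_vector_derivative s *\<^sub>R H (s * \<sigma>)) (at \<sigma> within {0..1})"
      if "\<sigma> \<in> {0..1}" for \<sigma>
    proof -
      have "((\<lambda>\<sigma>. s * \<sigma>) has_vector_derivative s) (at \<sigma> within {0..1})"
        by (auto intro!: derivative_eq_intros)
      moreover have "(P has_vector_derivative H (s * \<sigma>)) (at (s * \<sigma>) within (*) s ` {0..1})"
        by (rule has_vector_derivative_within_subset[OF P]) (use rng that in auto)
      ultimately show ?thesis
        using vector_diff_chain_within by (fastforce simp: o_def)
    qed
    then have "((\<lambda>\<sigma>. s *\<^sub>R H (s * \<sigma>)) has_integral P (s * 1) - P (s * 0)) {0..1}"
      by (intro fundamental_theorem_of_calculus) auto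
    from integral_unique[OF this] show ?thesis by simp
  qed
  have "((\<lambda>s. P s - P 0) has_vector_derivative H t) (at t within {-n<..<n})"
  proof -
    have "(P has_vector_derivative H t) (at t within {-n<..<n})"
      by (rule has_vector_derivative_within_subset[OF P]) (auto simp: n_def)
    from has_vector_derivative_diff[OF this has_vector_derivative_const] show ?thesis by simp
  qed
  then have "((\<lambda>s. P s - P 0) has_vector_derivative H t) (at t)"
    by (subst (asm) at_within_open) (auto simp: n_def)
  then show ?thesis
    by (rule has_vector_derivative_transform_within_open[where S="{-n<..<n}"])
       (use eq in \<open>auto simp: n_def\<close>)
qed

text \<open>Integrating an exponential of rate \<open>M\<close> gains the factor
  \<open>1 / M\<close>. In the weighted norm of the flow construction this gain yields the
  contraction, on all times at once.\<close>

lemma norm_scaled_integral_le_exp: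
  fixes h :: "real \<Rightarrow> 'a::banach"
  assumes "continuous_on {0..1} h" "M > 0"
    and "\<And>\<sigma>. \<sigma> \<in> {0..1} \<Longrightarrow> norm (h \<sigma>) \<le> D * exp (M * \<bar>t\<bar> * \<sigma>)"
  shows "norm (t *\<^sub>R integral {0..1} h) \<le> D / M * exp (M * \<bar>t\<bar>)"
proof -
  have "D \<ge> 0"
    using assms(3)[of 0] by (smt (verit) atLeastAtMost_iff exp_zero mult_cancel_left2 mult_zero_right norm_ge_zero)
  have "((\<lambda>\<sigma>. D / M * exp (M * \<bar>t\<bar> * \<sigma>)) has_vector_derivative \<bar>t\<bar> * (D * exp (M * \<bar>t\<bar> * \<sigma>)))
      (at \<sigma> within {0..1})" for \<sigma>
    using \<open>M > 0\<close>
    by (auto intro!: derivative_eq_intros simp: has_real_derivative_iff_has_vector_derivative[symmetric])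
  then have I: "((\<lambda>\<sigma>. \<bar>t\<bar> * (D * exp (M * \<bar>t\<bar> * \<sigma>))) has_integral
      D / M * exp (M * \<bar>t\<bar> * 1) - D / M * exp (M * \<bar>t\<bar> * 0)) {0..1}"
    by (intro fundamental_theorem_of_calculus) auto
  have "norm (integral {0..1} (\<lambda>\<sigma>. t *\<^sub>R h \<sigma>)) \<le> integral {0..1} (\<lambda>\<sigma>. \<bar>t\<bar> * (D * exp (M * \<bar>t\<bar> * \<sigma>)))"
  proof (rule integral_norm_bound_integral)
    show "(\<lambda>\<sigma>. t *\<^sub>R h \<sigma>) integrable_on {0..1}"
      by (intro integrable_continuous_interval continuous_intros assms)
    show "(\<lambda>\<sigma>. \<bar>t\<bar> * (D * exp (M * \<bar>t\<bar> * \<sigma>))) integrable_on {0..1}"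
      using I by blast
  qed (use assms in \<open>auto intro!: mult_left_mono\<close>)
  also have "\<dots> \<le> D / M * exp (M * \<bar>t\<bar>)"
    using integral_unique[OF I] \<open>D \<ge> 0\<close> \<open>M > 0\<close> by simp
  finally show ?thesis by simp
qed

text \<open>The contraction is on bounded continuous functions of the pair (parameter, time), weighted by
  \<open>exp (- M * \<bar>t\<bar>)\<close>, so that joint continuity of the fixed point is automatic.\<close>

lemma global_flow_with_parameter:
  fixes F :: "'p::metric_space \<Rightarrow> 'a::banach \<Rightarrow> 'a"
  assumes cont: "continuous_on UNIV (\<lambda>(p, x). F p x)"
    and lip: "\<And>p x y. norm (F p x - F p y) \<le> L * norm (x - y)"
    and bnd: "\<And>p. norm (F p 0) \<le> C"
  obtains X where "continuous_on UNIV (\<lambda>(p, t). X p t)" "\<And>p. X p 0 = x0"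
    "\<And>p t. (X p has_vector_derivative F p (X p t)) (at t)"
proof -
  \<comment> \<open>With this choice the contraction factor \<open>\<bar>L\<bar> / M\<close> is at
    most 1/2; the summand 1 keeps \<open>M\<close> positive when \<open>L = 0\<close>.\<close>
  define M where "M = 2 * \<bar>L\<bar> + 1"
  have "M > 0" by (simp add: M_def)
  have lip': "norm (F p x - F p y) \<le> \<bar>L\<bar> * norm (x - y)" for p x y
    using lip[of p x y] by (smt (verit) mult_right_mono norm_ge_zero)
  have contF: "continuous_on S (\<lambda>s. F (a s) (b s))" 
    if "continuous_on S a" "continuous_on S b" for S and a :: "'s::topological_space \<Rightarrow> 'p" and b
    using continuous_on_compose2[OF cont continuous_on_Pair[OF that]] by simp
  \<comment> \<open>\<open>J\<close> is the Picard operator written for a weighted function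
    \<open>W\<close>: the unweighted candidate is \<open>W\<close> times the growing exponential.
    \<open>T\<close> multiplies the result by the decaying weight again.\<close>
  define J where "J W p t = x0 + t *\<^sub>R integral {0..1} (\<lambda>\<sigma>. F p (exp (M * \<bar>t * \<sigma>\<bar>) *\<^sub>R W (p, t * \<sigma>)))"
    for W :: "'p \<times> real \<Rightarrow> 'a" and p t
  define T where "T W = (\<lambda>(p, t). exp (- (M * \<bar>t\<bar>)) *\<^sub>R J W p t)" for W
  have contI: "continuous_on S (\<lambda>\<sigma>. F p (exp (M * \<bar>t * \<sigma>\<bar>) *\<^sub>R W (p, t * \<sigma>)))"
    if "continuous_on UNIV W" for S W p t
    by (intro contF continuous_intros continuous_on_compose2[OF that]) auto
  have T_cont: "continuous_on UNIV (T W)" if W: "continuous_on UNIV W" for W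
  proof -
    have "continuous_on (UNIV \<times> cbox 0 1) (\<lambda>z. F (fst (fst z)) (exp (M * \<bar>snd (fst z) * snd z\<bar>) *\<^sub>R W (fst (fst z), snd (fst z) * snd z)))"
      by (intro contF continuous_intros continuous_on_compose2[OF W]) auto
    then have "continuous_on (UNIV \<times> cbox 0 1)
        (\<lambda>(z, \<sigma>). F (fst z) (exp (M * \<bar>snd z * \<sigma>\<bar>) *\<^sub>R W (fst z, snd z * \<sigma>)))"
      by (simp add: case_prod_beta)
    from integral_continuous_on_param[OF this]
    show ?thesis
      by (auto simp: T_def J_def case_prod_beta intro!: continuous_intros)
  qed
  \<comment> \<open>The Lipschitz condition and the bound at 0 give linear growth of
    \<open>F p\<close>, uniformly in \<open>p\<close>, so \<open>T\<close> preserves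
    boundedness.\<close>
  have T_bdd: "norm (T W z) \<le> norm x0 + (C + \<bar>L\<bar> * B) / M"
    if W: "continuous_on UNIV W" and B: "\<And>z. norm (W z) \<le> B" for W B z
  proof -
    obtain p t where z: "z = (p, t)" by force
    have "norm (F p (exp (M * \<bar>t * \<sigma>\<bar>) *\<^sub>R W (p, t * \<sigma>))) \<le> (C + \<bar>L\<bar> * B) * exp (M * \<bar>t\<bar> * \<sigma>)"
      if \<sigma>: "\<sigma> \<in> {0..1}" for \<sigma>
    proof -
      define e where "e = exp (M * \<bar>t\<bar> * \<sigma>)"
      have e: "exp (M * \<bar>t * \<sigma>\<bar>) = e" "e \<ge> 1"
        using \<sigma> \<open>M > 0\<close> by (simp_all add: e_def abs_mult mult.assoc)
      have C: "C \<ge> 0" using bnd[of p] norm_ge_zero order_trans by blast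
      have "norm (F p (e *\<^sub>R W (p, t * \<sigma>))) \<le> norm (F p 0) + \<bar>L\<bar> * norm (e *\<^sub>R W (p, t * \<sigma>))"
        using lip'[of p "e *\<^sub>R W (p, t * \<sigma>)" 0] by (smt (verit) diff_zero norm_triangle_sub)
      also have "\<dots> \<le> C + \<bar>L\<bar> * (e * B)"
        using e B[of "(p, t * \<sigma>)"] bnd[of p] by (intro add_mono mult_left_mono) (auto intro!: mult_left_mono)
      also have "\<dots> \<le> (C + \<bar>L\<bar> * B) * e"
        using mult_left_mono[OF e(2) C] by (simp add: algebra_simps)
      finally show ?thesis by (simp add: e e_def[symmetric])
    qed
    then have "norm (t *\<^sub>R integral {0..1} (\<lambda>\<sigma>. F p (exp (M * \<bar>t * \<sigma>\<bar>) *\<^sub>R W (p, t * \<sigma>))))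
        \<le> (C + \<bar>L\<bar> * B) / M * exp (M * \<bar>t\<bar>)"
      by (intro norm_scaled_integral_le_exp contI W \<open>M > 0\<close>)
    then have "norm (J W p t) \<le> norm x0 + (C + \<bar>L\<bar> * B) / M * exp (M * \<bar>t\<bar>)"
      unfolding J_def using norm_triangle_le by (smt (verit))
    then have "norm (T W z) \<le> exp (- (M * \<bar>t\<bar>)) * (norm x0 + (C + \<bar>L\<bar> * B) / M * exp (M * \<bar>t\<bar>))"
      by (simp add: T_def z)
    also have "\<dots> = exp (- (M * \<bar>t\<bar>)) * norm x0 + (C + \<bar>L\<bar> * B) / M"
      by (simp add: algebra_simps exp_minus)
    also have "\<dots> \<le> norm x0 + (C + \<bar>L\<bar> * B) / M"
      using \<open>M > 0\<close> by (simp add: mult_left_le_one_le)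
    finally show ?thesis .
  qed
  have T_lip: "norm (T W z - T W' z) \<le> 1 / 2 * D"
    if W: "continuous_on UNIV W" "continuous_on UNIV W'" and D: "\<And>z. norm (W z - W' z) \<le> D" for W W' z D
  proof -
    obtain p t where z: "z = (p, t)" by force
    have D0: "D \<ge> 0" using D norm_ge_zero order_trans by blast
    let ?h = "\<lambda>W \<sigma>. F p (exp (M * \<bar>t * \<sigma>\<bar>) *\<^sub>R W (p, t * \<sigma>))"
    have int: "?h W integrable_on {0..1}" "?h W' integrable_on {0..1}"
      by (intro integrable_continuous_interval contI W)+
    have "norm (?h W \<sigma> - ?h W' \<sigma>) \<le> (\<bar>L\<bar> * D) * exp (M * \<bar>t\<bar> * \<sigma>)" if \<sigma>: "\<sigma> \<in> {0..1}" for \<sigma>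
    proof -
      define e where "e = exp (M * \<bar>t\<bar> * \<sigma>)"
      have e: "exp (M * \<bar>t * \<sigma>\<bar>) = e" "e \<ge> 1"
        using \<sigma> \<open>M > 0\<close> by (simp_all add: e_def abs_mult mult.assoc)
      have "norm (?h W \<sigma> - ?h W' \<sigma>) \<le> \<bar>L\<bar> * norm (e *\<^sub>R (W (p, t * \<sigma>) - W' (p, t * \<sigma>)))"
        unfolding e scaleR_diff_right by (rule lip')
      also have "\<dots> \<le> \<bar>L\<bar> * (e * D)"
        using e D by (auto intro!: mult_left_mono)
      finally show ?thesis by (simp add: e_def mult_ac)
    qed
    then have "norm (t *\<^sub>R integral {0..1} (\<lambda>\<sigma>. ?h W \<sigma> - ?h W' \<sigma>)) \<le> \<bar>L\<bar> * D / M * exp (M * \<bar>t\<bar>)"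
      by (intro norm_scaled_integral_le_exp continuous_on_diff contI W \<open>M > 0\<close>)
    then have "norm (J W p t - J W' p t) \<le> \<bar>L\<bar> * D / M * exp (M * \<bar>t\<bar>)"
      by (simp add: J_def integral_diff[OF int] scaleR_diff_right)
    then have "exp (- (M * \<bar>t\<bar>)) * norm (J W p t - J W' p t) \<le> exp (- (M * \<bar>t\<bar>)) * (\<bar>L\<bar> * D / M * exp (M * \<bar>t\<bar>))"
      by (intro mult_left_mono) auto
    also have "\<dots> = \<bar>L\<bar> / M * D"
      by (simp add: exp_minus)
    also have "\<dots> \<le> 1 / 2 * D"
      using D0 \<open>M > 0\<close> by (intro mult_right_mono) (simp_all add: M_def field_simps)
    finally show ?thesis
      by (simp add: T_def z flip: scaleR_diff_right)
  qed
  define T' :: "(('p \<times> real) \<Rightarrow>\<^sub>C 'a) \<Rightarrow> (('p \<times> real) \<Rightarrow>\<^sub>C 'a)" where "T' W = Bcontfun (T (apply_bcontfun W))" for W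
  have T': "apply_bcontfun (T' W) = T (apply_bcontfun W)" for W
  proof -
    obtain B where "\<And>z. norm (apply_bcontfun W z) \<le> B"
      using bounded_apply_bcontfun[of W] unfolding bounded_iff by auto
    then have "bounded (range (T (apply_bcontfun W)))"
      using T_bdd[of "apply_bcontfun W" B] unfolding bounded_iff by auto
    then have "T (apply_bcontfun W) \<in> bcontfun"
      by (simp add: bcontfun_def T_cont)
    then show ?thesis
      by (simp add: T'_def Bcontfun_inverse)
  qed
  have "dist (T' W) (T' W') \<le> 1 / 2 * dist W W'" for W W'
    by (rule dist_bound)
       (use dist_bounded[of W _ W'] in \<open>auto simp: T' dist_norm[of "T _ _"] dist_norm[of "apply_bcontfun _ _"] intro!: T_lip[simplified]\<close>)
  then obtain W where "T' W = W"
    using banach_fix_type[of "1/2" T'] by auto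
  then have W: "T (apply_bcontfun W) = apply_bcontfun W"
    using T' by metis
  define X where "X p t = exp (M * \<bar>t\<bar>) *\<^sub>R apply_bcontfun W (p, t)" for p t
  have X: "X p t = x0 + t *\<^sub>R integral {0..1} (\<lambda>\<sigma>. F p (X p (t * \<sigma>)))" for p t
  proof -
    have "X p t = exp (M * \<bar>t\<bar>) *\<^sub>R T (apply_bcontfun W) (p, t)"
      by (simp add: X_def W)
    also have "\<dots> = J (apply_bcontfun W) p t"
      by (simp add: T_def exp_minus)
    finally show ?thesis by (simp add: J_def X_def)
  qed
  show thesis
  proof
    show cX: "continuous_on UNIV (\<lambda>(p, t). X p t)"
      unfolding X_def case_prod_beta by (intro continuous_intros continuous_on_compose2[OF continuous_on_apply_bcontfun[of UNIV]]) auto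
    show "X p 0 = x0" for p
      by (subst X) simp
    show "(X p has_vector_derivative F p (X p t)) (at t)" for p t
    proof -
      have "continuous_on UNIV (X p)"
        using continuous_on_compose2[OF cX, of UNIV "\<lambda>t. (p, t)"] by (simp add: continuous_intros)
      then have "continuous_on UNIV (\<lambda>t. F p (X p t))"
        by (intro contF continuous_intros)
      from scaled_integral_has_vector_derivative[OF this, of t]
      have "((\<lambda>t. x0 + t *\<^sub>R integral {0..1} (\<lambda>\<sigma>. F p (X p (t * \<sigma>)))) has_vector_derivative F p (X p t)) (at t)"
        using has_vector_derivative_add[OF has_vector_derivative_const] by fastforce
      then show ?thesis
        using X[abs_def] by (simp flip: X)
    qed
  qed
qed

text \<open>The squared distance has derivative at least \<open>- 2 * L\<close> times itself, so its
  product with \<open>exp (2 * L * s)\<close> is nondecreasing; being 0 at \<open>t0\<close>, it is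
  0 before. The backward direction carries an equilibrium met at a later time back to time
  0.\<close>

lemma solution_unique_backward:
  fixes X Y :: "real \<Rightarrow> 'a::real_inner"
  assumes X: "\<And>t. (X has_vector_derivative F (X t)) (at t)"
    and Y: "\<And>t. (Y has_vector_derivative F (Y t)) (at t)"
    and lip: "\<And>x y. norm (F x - F y) \<le> L * norm (x - y)"
    and "X t0 = Y t0" "t \<le> t0"
  shows "X t = Y t"
proof -
  define y where "y s = exp (2 * L * s) * ((X s - Y s) \<bullet> (X s - Y s))" for s
  have "\<exists>d. (y has_real_derivative d) (at s) \<and> 0 \<le> d" for s
  proof -
    let ?D = "X s - Y s" and ?E = "F (X s) - F (Y s)"
    have "((\<lambda>s. X s - Y s) has_vector_derivative ?E) (at s)"
      by (intro derivative_intros X Y)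
    then have "((\<lambda>s. (X s - Y s) \<bullet> (X s - Y s)) has_vector_derivative (?D \<bullet> ?E + ?E \<bullet> ?D)) (at s)"
      by (rule bounded_bilinear.has_vector_derivative[OF bounded_bilinear_inner])
         (simp add: X Y has_vector_derivative_diff)
    then have *: "((\<lambda>s. (X s - Y s) \<bullet> (X s - Y s)) has_real_derivative 2 * (?D \<bullet> ?E)) (at s)"
      by (simp add: has_real_derivative_iff_has_vector_derivative inner_commute)
    have "(y has_real_derivative exp (2 * L * s) * (2 * L * (?D \<bullet> ?D) + 2 * (?D \<bullet> ?E))) (at s)"
      unfolding y_def
      by (rule DERIV_cong[OF DERIV_mult[OF _ *], of _ "2 * L * exp (2 * L * s)"])
         (auto intro!: derivative_eq_intros simp: algebra_simps)
    moreover have "\<bar>?D \<bullet> ?E\<bar> \<le> norm ?D * (L * norm ?D)"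
      using Cauchy_Schwarz_ineq2[of ?D ?E] lip[of "X s" "Y s"] by (meson mult_left_mono norm_ge_zero order_trans)
    then have "- (?D \<bullet> ?E) \<le> L * (?D \<bullet> ?D)"
      by (simp add: dot_square_norm power2_eq_square algebra_simps)
    ultimately show ?thesis
      by (intro exI conjI) (assumption, simp)
  qed
  then have "y t \<le> y t0"
    using \<open>t \<le> t0\<close> by (intro DERIV_nonneg_imp_nondecreasing[of t t0 y]) auto
  then have "(X t - Y t) \<bullet> (X t - Y t) \<le> 0"
    using \<open>X t0 = Y t0\<close> by (simp add: y_def mult_le_0_iff)
  then show ?thesis
    using inner_ge_zero[of "X t - Y t"] by (metis eq_iff_diff_eq_0 inner_eq_zero_iff order_antisym)
qed

section \<open>Shooting\<close>

text \<open>By the tube lemma, an open condition that holds at all times of a compact interval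
  survives small changes of the parameter. This makes the shooting alternatives open.\<close>

lemma open_forall_compact:
  assumes "compact K" "open W"
  shows "open {x. \<forall>s\<in>K. (x, s) \<in> W}"
proof (subst open_subopen, clarify)
  fix x assume "\<forall>s\<in>K. (x, s) \<in> W"
  then have "{x} \<times> K \<subseteq> W" by auto
  from Elementary_Topology.tube_lemma[OF assms this] obtain U where U: "x \<in> U" "open U" "U \<times> K \<subseteq> W" by blast
  show "\<exists>T. open T \<and> x \<in> T \<and> T \<subseteq> {x. \<forall>s\<in>K. (x, s) \<in> W}"
    by (rule exI[of _ U]) (use U in auto)
qed

lemma bounded_mono_tendsto_at_top:
  fixes y :: "real \<Rightarrow> real"
  assumes mono: "\<And>s t. T \<le> s \<Longrightarrow> s \<le> t \<Longrightarrow> y s \<le> y t" and B: "\<And>t. T \<le> t \<Longrightarrow> y t \<le> B"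
  obtains l where "(y \<longlongrightarrow> l) at_top" "\<And>t. T \<le> t \<Longrightarrow> y t \<le> l" "l \<le> B"
proof
  define l where "l = Sup (y ` {T..})"
  have bdd: "bdd_above (y ` {T..})"
    using B by (auto simp: bdd_above_def)
  show le: "y t \<le> l" if "T \<le> t" for t
    unfolding l_def by (rule cSup_upper[OF _ bdd]) (use that in auto)
  show "l \<le> B"
    unfolding l_def by (rule cSup_least) (use B in auto)
  show "(y \<longlongrightarrow> l) at_top"
  proof (rule increasing_tendsto)
    show "\<forall>\<^sub>F t in at_top. y t \<le> l"
      using eventually_ge_at_top[of T] by eventually_elim (rule le)
    fix x assume "x < l"
    then obtain s where s: "s \<ge> T" "x < y s"
      unfolding l_def using less_cSup_iff[OF _ bdd] by auto
    show "\<forall>\<^sub>F t in at_top. x < y t"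
      using eventually_ge_at_top[of s] by eventually_elim (use mono[of s] s in force)
  qed
qed

text \<open>By the mean value theorem the increments over intervals of length 1, which tend to 0,
  are values of \<open>y'\<close> at points escaping to infinity, which tend to
  \<open>m\<close>.\<close>

lemma tendsto_deriv_imp_zero:
  fixes y :: "real \<Rightarrow> real"
  assumes der: "\<And>t. t \<ge> T \<Longrightarrow> (y has_real_derivative y' t) (at t)"
    and y: "(y \<longlongrightarrow> l) at_top" and y': "(y' \<longlongrightarrow> m) at_top"
  shows "m = 0"
proof -
  have "\<exists>\<xi>. t < \<xi> \<and> y (t + 1) - y t = y' \<xi>" if "t \<ge> T" for t
    using MVT2[of t "t + 1" y y'] der that by auto
  then obtain \<xi> where \<xi>: "\<And>t. t \<ge> T \<Longrightarrow> t < \<xi> t \<and> y (t + 1) - y t = y' (\<xi> t)"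
    by metis
  have "filterlim \<xi> at_top at_top"
    by (rule filterlim_at_top_mono[OF filterlim_ident])
       (use eventually_ge_at_top[of T] in \<open>eventually_elim, use \<xi> in force\<close>)
  from filterlim_compose[OF y' this] have "((\<lambda>t. y' (\<xi> t)) \<longlongrightarrow> m) at_top" .
  moreover have "((\<lambda>t. y (t + 1)) \<longlongrightarrow> l) at_top"
    by (rule filterlim_compose[OF y]) (rule filterlim_at_top_mono[OF filterlim_ident], auto)
  then have "((\<lambda>t. y (t + 1) - y t) \<longlongrightarrow> l - l) at_top"
    by (intro tendsto_diff y)
  then have "((\<lambda>t. y' (\<xi> t)) \<longlongrightarrow> 0) at_top"
    using Lim_transform_eventually[of _ "l - l" at_top "\<lambda>t. y' (\<xi> t)"] eventually_ge_at_top[of T] \<xi>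
    by (smt (verit) diff_self eventually_mono)
  ultimately show ?thesis
    by (rule tendsto_unique[rotated, OF _ _]) simp
qed

text \<open>Here \<open>g\<close> plays the part of \<open>f\<close> after a change outside the
  interval from \<alpha> to \<open>a\<^sub>1\<close>. Positivity on the whole half-line left of
  \<open>a\<^sub>0\<close> lets the forcing act also below \<alpha>; \<open>lower\<close> is what
  makes the speed \<open>L + 1\<close> fast enough.\<close>

locale shooting =
  fixes g :: "real \<Rightarrow> real" and \<alpha> a\<^sub>0 a\<^sub>1 L :: real
  assumes lip: "\<And>x y. \<bar>g x - g y\<bar> \<le> L * \<bar>x - y\<bar>"
    and less: "\<alpha> < a\<^sub>0" "a\<^sub>0 < a\<^sub>1"
    and zero: "g a\<^sub>0 = 0" "g a\<^sub>1 = 0"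
    and pos: "\<And>x. x < a\<^sub>0 \<Longrightarrow> 0 < g x"
    and neg: "\<And>x. a\<^sub>0 < x \<Longrightarrow> x < a\<^sub>1 \<Longrightarrow> g x < 0"
    and lower: "\<And>x. 0 \<le> g x + L * (x - \<alpha>)"
    and integral_neg: "integral {\<alpha>..a\<^sub>1} g < 0"
begin

definition trajectory :: "real \<Rightarrow> (real \<Rightarrow> real) \<Rightarrow> (real \<Rightarrow> real) \<Rightarrow> bool" where
  "trajectory k u v \<longleftrightarrow> u 0 = \<alpha> \<and> v 0 = 0 \<and>
     (\<forall>t. (u has_real_derivative v t) (at t)) \<and>
     (\<forall>t. (v has_real_derivative k * v t + g (u t)) (at t))"

lemma continuous_g: "continuous_on S g"
proof -
  have "L-lipschitz_on UNIV g"
    using lip[of 0 1] lip by (intro lipschitz_onI) (auto simp: dist_real_def)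
  then show ?thesis
    using lipschitz_on_continuous_on continuous_on_subset by blast
qed

lemma L_nonneg: "0 \<le> L"
  using lip[of 0 1] by auto

lemma trajectoryD:
  assumes "trajectory k u v"
  shows "u 0 = \<alpha>" "v 0 = 0" "(u has_real_derivative v t) (at t)"
    "(v has_real_derivative k * v t + g (u t)) (at t)"
    "isCont u t" "isCont v t" "continuous_on S u" "continuous_on S v"
  using assms unfolding trajectory_def
  by (auto intro: DERIV_isCont continuous_at_imp_continuous_on)

lemma field_lipschitz:
  fixes k :: real
  shows "norm ((snd x, k * snd x + g (fst x)) - (snd y, k * snd y + g (fst y)))
    \<le> (1 + \<bar>k\<bar> + L) * norm (x - y)"
proof -
  have "norm ((snd x, k * snd x + g (fst x)) - (snd y, k * snd y + g (fst y)))
      \<le> \<bar>snd x - snd y\<bar> + \<bar>k * (snd x - snd y) + (g (fst x) - g (fst y))\<bar>"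
    using norm_Pair_le[of "snd x - snd y" "k * snd x + g (fst x) - (k * snd y + g (fst y))"]
    by (simp add: algebra_simps)
  also have "\<dots> \<le> \<bar>snd x - snd y\<bar> + (\<bar>k\<bar> * \<bar>snd x - snd y\<bar> + L * \<bar>fst x - fst y\<bar>)"
    using lip[of "fst x" "fst y"] abs_triangle_ineq[of "k * (snd x - snd y)" "g (fst x) - g (fst y)"]
    by (simp add: abs_mult)
  also have "\<dots> \<le> norm (x - y) + (\<bar>k\<bar> * norm (x - y) + L * norm (x - y))"
  proof -
    have "\<bar>fst x - fst y\<bar> \<le> norm (x - y)" "\<bar>snd x - snd y\<bar> \<le> norm (x - y)"
      using norm_fst_le[of "fst x - fst y" "snd x - snd y"] norm_snd_le[of "snd x - snd y" "fst x - fst y"]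
      by (simp_all flip: fst_diff snd_diff)
    then show ?thesis
      using L_nonneg by (intro add_mono mult_left_mono) auto
  qed
  finally show ?thesis by (simp add: algebra_simps)
qed

lemma trajectory_family:
  obtains u v where "continuous_on UNIV (\<lambda>(k, t). u k t)" "continuous_on UNIV (\<lambda>(k, t). v k t)"
    "\<And>k. 0 \<le> k \<Longrightarrow> k \<le> K \<Longrightarrow> trajectory k (u k) (v k)"
proof -
  \<comment> \<open>Clamping the speed gives one Lipschitz constant for all parameters while the
    parameter space stays the whole line; between 0 and \<open>K\<close> nothing changes.\<close>
  define \<kappa> where "\<kappa> k = max 0 (min k K)" for k :: real
  define F where "F k x = (snd x, \<kappa> k * snd x + g (fst x))" for k x
  have "continuous_on UNIV (\<lambda>(k, x). F k x)"
    unfolding F_def \<kappa>_def case_prod_beta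
    by (intro continuous_intros continuous_on_compose2[OF continuous_g[of UNIV]]) auto
  moreover have "norm (F k x - F k y) \<le> (1 + \<bar>K\<bar> + L) * norm (x - y)" for k x y
  proof -
    have "(1 + \<bar>\<kappa> k\<bar> + L) * norm (x - y) \<le> (1 + \<bar>K\<bar> + L) * norm (x - y)"
      by (intro mult_right_mono) (auto simp: \<kappa>_def)
    then show ?thesis
      using field_lipschitz[of x "\<kappa> k" y] by (simp add: F_def)
  qed
  moreover have "norm (F k 0) \<le> \<bar>g 0\<bar>" for k
    by (simp add: F_def norm_Pair)
  ultimately obtain X where X: "continuous_on UNIV (\<lambda>(k, t). X k t)" "\<And>k. X k 0 = (\<alpha>, 0)"
    "\<And>k t. (X k has_vector_derivative F k (X k t)) (at t)"
    using global_flow_with_parameter by blast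
  show thesis
  proof
    show "continuous_on UNIV (\<lambda>(k, t). fst (X k t))" "continuous_on UNIV (\<lambda>(k, t). snd (X k t))"
      using X(1) by (auto simp: case_prod_beta intro: continuous_intros)
    fix k assume "0 \<le> k" "k \<le> K"
    then have "\<kappa> k = k" by (simp add: \<kappa>_def)
    moreover have "((\<lambda>t. fst (X k t)) has_vector_derivative fst (F k (X k t))) (at t)"
      "((\<lambda>t. snd (X k t)) has_vector_derivative snd (F k (X k t))) (at t)" for t
      by (rule bounded_linear.has_vector_derivative[OF bounded_linear_fst X(3)]
               bounded_linear.has_vector_derivative[OF bounded_linear_snd X(3)])+
    ultimately show "trajectory k (\<lambda>t. fst (X k t)) (\<lambda>t. snd (X k t))"
      by (simp add: trajectory_def X(2) F_def has_real_derivative_iff_has_vector_derivative)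
  qed
qed

text \<open>Otherwise the state at time \<open>t\<close> would be a rest point of the first-order
  system, and backward uniqueness would place the trajectory there at time 0, although
  \<open>g \<alpha> > 0\<close>.\<close>

lemma trajectory_avoids_equilibria:
  assumes tr: "trajectory k u v" and "0 \<le> t" "v t = 0"
  shows "g (u t) \<noteq> 0"
proof
  assume 0: "g (u t) = 0"
  define F where "F x = (snd x, k * snd x + g (fst x))" for x
  have "((\<lambda>s. (u s, v s)) has_vector_derivative F (u s, v s)) (at s)" for s
    unfolding F_def
    using trajectoryD(3,4)[OF tr, of s]
    by (auto simp: has_real_derivative_iff_has_vector_derivative intro!: has_vector_derivative_Pair)
  moreover have "((\<lambda>s. (u t, 0)) has_vector_derivative F (u t, 0)) (at s)" for s
    by (simp add: F_def 0 flip: zero_prod_def)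
  moreover have "norm (F x - F y) \<le> (1 + \<bar>k\<bar> + L) * norm (x - y)" for x y
    unfolding F_def by (rule field_lipschitz)
  ultimately have "(u 0, v 0) = (u t, 0)"
    using solution_unique_backward[of "\<lambda>s. (u s, v s)" F "\<lambda>s. (u t, 0)" "1 + \<bar>k\<bar> + L" t 0] assms by simp
  then have "g \<alpha> = 0"
    using 0 trajectoryD(1)[OF tr] by simp
  then show False using pos[of \<alpha>] less by simp
qed

section \<open>Sign of the velocity and the two extreme speeds\<close>

lemma velocity_nonneg_while_forced:
  assumes tr: "trajectory k u v" and "0 \<le> t" and *: "\<And>s. s \<in> {0..t} \<Longrightarrow> u s < a\<^sub>0 \<or> 0 < v s"
  shows "0 \<le> v t"
proof (rule ccontr)
  assume neg: "\<not> 0 \<le> v t"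
  have "compact ({0..t} \<inter> {s. 0 \<le> v s})"
    by (intro compact_Int_closed closed_Collect_le continuous_intros trajectoryD(8)[OF tr]) auto
  moreover have "0 \<in> {0..t} \<inter> {s. 0 \<le> v s}"
    using \<open>0 \<le> t\<close> trajectoryD(2)[OF tr] by simp
  ultimately obtain r where r: "r \<in> {0..t}" "0 \<le> v r" "\<And>s. s \<in> {0..t} \<Longrightarrow> 0 \<le> v s \<Longrightarrow> s \<le> r"
    using compact_attains_sup[of "{0..t} \<inter> {s. 0 \<le> v s}"] by (metis (lifting) IntE IntI empty_iff mem_Collect_eq)
  \<comment> \<open>After the last time \<open>r\<close> of nonnegative velocity, the hypothesis
    leaves only the alternative \<open>u s < a\<^sub>0\<close>, where \<open>g\<close> is positive.
    The integrating factor turns this into growth of \<open>y\<close>, which cannot then become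
    negative at \<open>t\<close>.\<close>
  define y where "y s = exp (- k * s) * v s" for s
  have "y r \<le> y t"
  proof (rule DERIV_nonneg_imp_increasing_open[of r t y])
    show "r \<le> t" using r by simp
    show "continuous_on {r..t} y"
      unfolding y_def by (intro continuous_intros trajectoryD(8)[OF tr])
  next
    fix s assume s: "r < s" "s < t"
    then have "v s < 0" using r(1) r(3)[of s] by force
    then have "g (u s) > 0" using *[of s] s r(1) by (intro pos) auto
    moreover have "(y has_real_derivative exp (- k * s) * g (u s)) (at s)"
      unfolding y_def
      by (rule DERIV_cong[OF DERIV_mult[OF _ trajectoryD(4)[OF tr]], of _ "- k * exp (- k * s)"])
         (auto intro!: derivative_eq_intros simp: algebra_simps)
    ultimately show "\<exists>d. (y has_real_derivative d) (at s) \<and> d \<ge> 0"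
      by (intro exI conjI) (assumption, simp)
  qed
  moreover have "y r \<ge> 0" "y t < 0"
    using r neg by (auto simp: y_def mult_less_0_iff)
  ultimately show False by simp
qed

text \<open>\<open>G\<close> is the integral of \<open>g\<close> from \<alpha>. The conserved energy
  starts at 0, so the kinetic term equals \<open>G (u t)\<close>; as \<open>G a\<^sub>1 < 0\<close>,
  the value \<open>a\<^sub>1\<close> can be neither reached nor approached as a limit.\<close>

lemma energy:
  assumes tr: "trajectory 0 u v"
  obtains G where "continuous_on UNIV G" "G a\<^sub>1 < 0" "\<And>t. (v t)\<^sup>2 / 2 = G (u t)"
proof -
  \<comment> \<open>An antiderivative on the whole line, since \<open>u\<close> is not known to stay
    between \<alpha> and \<open>a\<^sub>1\<close>.\<close>
  define P where "P x = x *\<^sub>R integral {0..1} (\<lambda>\<sigma>. g (x * \<sigma>))" for x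
  have P: "(P has_real_derivative g x) (at x)" for x
    unfolding P_def has_real_derivative_iff_has_vector_derivative
    by (rule scaled_integral_has_vector_derivative[OF continuous_g])
  have int: "(g has_integral P a\<^sub>1 - P \<alpha>) {\<alpha>..a\<^sub>1}"
    using less P
    by (intro fundamental_theorem_of_calculus)
       (auto simp: has_real_derivative_iff_has_vector_derivative has_vector_derivative_at_within)
  show thesis
  proof
    show "continuous_on UNIV (\<lambda>x. P x - P \<alpha>)"
      using P by (intro continuous_intros continuous_at_imp_continuous_on) (blast intro: DERIV_isCont)
    show "P a\<^sub>1 - P \<alpha> < 0"
      using integral_unique[OF int] integral_neg by simp
    show "(v t)\<^sup>2 / 2 = P (u t) - P \<alpha>" for t
    proof -
      have "((\<lambda>t. (v t)\<^sup>2 / 2 - P (u t)) has_real_derivative 0) (at t)" for t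
        by (auto intro!: derivative_eq_intros trajectoryD[OF tr] DERIV_chain2[OF P])
      then have "(v t)\<^sup>2 / 2 - P (u t) = (v 0)\<^sup>2 / 2 - P (u 0)"
        by (rule DERIV_isconst_all[rule_format, rotated]) 
      then show ?thesis
        by (simp add: trajectoryD[OF tr])
    qed
  qed
qed

text \<open>At speed \<open>L + 1\<close> the difference of \<open>v\<close> and
  \<open>u - \<alpha>\<close> has derivative \<open>L\<close> times itself plus
  \<open>g u + L * (u - \<alpha>)\<close>, which is nonnegative by \<open>lower\<close>. Hence
  \<open>v \<ge> u - \<alpha>\<close>, and this inequality in turn keeps \<open>u - \<alpha>\<close>
  nonnegative.\<close>

lemma velocity_nonneg_fast:
  assumes tr: "trajectory (L + 1) u v" and "0 \<le> t"
  shows "0 \<le> v t"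
proof -
  define w where "w s = exp (- L * s) * (v s - (u s - \<alpha>))" for s
  define z where "z s = exp (- s) * (u s - \<alpha>)" for s
  have w: "0 \<le> w t" if "0 \<le> t" for t
  proof -
    have "(w has_real_derivative exp (- L * s) * (g (u s) + L * (u s - \<alpha>))) (at s)" for s
      unfolding w_def
      by (auto intro!: derivative_eq_intros trajectoryD[OF tr] simp: algebra_simps)
    then have "w 0 \<le> w t"
      using that lower by (intro DERIV_nonneg_imp_nondecreasing[of 0 t w]) (auto intro!: exI mult_nonneg_nonneg)
    then show ?thesis by (simp add: w_def trajectoryD[OF tr])
  qed
  have "(z has_real_derivative exp (- s) * (v s - (u s - \<alpha>))) (at s)" for s
    unfolding z_def
    by (auto intro!: derivative_eq_intros trajectoryD[OF tr] simp: algebra_simps)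
  then have "z 0 \<le> z t"
    using \<open>0 \<le> t\<close> w by (intro DERIV_nonneg_imp_nondecreasing[of 0 t z]) (auto intro!: exI simp: w_def zero_le_mult_iff)
  then have "u t \<ge> \<alpha>" by (simp add: z_def trajectoryD[OF tr] zero_le_mult_iff)
  then show ?thesis
    using w[OF \<open>0 \<le> t\<close>] by (simp add: w_def zero_le_mult_iff)
qed

text \<open>\<open>notA\<close> and \<open>notB\<close> negate the two shooting alternatives. At the
  first arrival at \<open>a\<^sub>1\<close> the velocity must be positive, so the trajectory
  overshoots; \<open>notB\<close> then supplies an earlier stop at or beyond
  \<open>a\<^sub>0\<close>, and that stop would be an equilibrium.\<close>

lemma trajectory_stays_below:
  assumes tr: "trajectory k u v" and "0 \<le> t"
    and notA: "\<And>t. 0 < t \<Longrightarrow> v t < 0 \<Longrightarrow> \<exists>s\<in>{0..t}. a\<^sub>1 \<le> u s"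
    and notB: "\<And>t. 0 < t \<Longrightarrow> a\<^sub>1 < u t \<Longrightarrow> \<exists>s\<in>{0..t}. a\<^sub>0 \<le> u s \<and> v s \<le> 0"
  shows "u t < a\<^sub>1"
proof (rule ccontr)
  assume "\<not> u t < a\<^sub>1"
  have "compact ({0..t} \<inter> {s. a\<^sub>1 \<le> u s})"
    by (intro compact_Int_closed closed_Collect_le continuous_intros trajectoryD(7)[OF tr]) auto
  moreover have "t \<in> {0..t} \<inter> {s. a\<^sub>1 \<le> u s}"
    using \<open>0 \<le> t\<close> \<open>\<not> u t < a\<^sub>1\<close> by simp
  ultimately obtain r where r: "r \<in> {0..t}" "a\<^sub>1 \<le> u r" "\<And>s. s \<in> {0..t} \<Longrightarrow> a\<^sub>1 \<le> u s \<Longrightarrow> r \<le> s"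
    using compact_attains_inf[of "{0..t} \<inter> {s. a\<^sub>1 \<le> u s}"] by (metis (lifting) IntE IntI empty_iff mem_Collect_eq)
  have "r \<noteq> 0" using r(2) less trajectoryD(1)[OF tr] by auto
  then have "0 < r" using r(1) by simp
  have below: "u s < a\<^sub>1" if "0 \<le> s" "s < r" for s
    using r(1) r(3)[of s] that by force
  have nonneg: "0 \<le> v s" if "0 \<le> s" "s < r" for s
    using notA[of s] below trajectoryD(2)[OF tr] that by (cases "s = 0") force+
  have "continuous_on {0..r} u" by (rule trajectoryD(7)[OF tr])
  have "u r = a\<^sub>1"
  proof (rule ccontr)
    assume "u r \<noteq> a\<^sub>1"
    then obtain s where "0 \<le> s" "s \<le> r" "u s = a\<^sub>1"
      using IVT'[of u 0 a\<^sub>1 r] r \<open>0 < r\<close> less trajectoryD(1)[OF tr] \<open>continuous_on {0..r} u\<close> by auto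
    then show False using below[of s] \<open>u r \<noteq> a\<^sub>1\<close> by force
  qed
  have "v r \<ge> 0"
  proof (rule tendsto_lowerbound)
    show "(v \<longlongrightarrow> v r) (at_left r)"
      using trajectoryD(6)[OF tr, of r] by (simp add: isCont_def filterlim_at_split)
    show "\<forall>\<^sub>F s in at_left r. 0 \<le> v s"
      using eventually_at_left_real[OF \<open>0 < r\<close>] by eventually_elim (auto intro: nonneg)
  qed simp
  moreover have "v r \<noteq> 0"
    using trajectory_avoids_equilibria[OF tr, of r] \<open>0 < r\<close> \<open>u r = a\<^sub>1\<close> zero by auto
  ultimately have "0 < v r" by simp
  then obtain d where d: "0 < d" "\<And>s. \<bar>s - r\<bar> < d \<Longrightarrow> 0 < v s"
    using continuous_at_eps_delta[of r v, THEN iffD1, OF trajectoryD(6)[OF tr], rule_format, of "v r"]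
    by (force simp: dist_real_def)
  \<comment> \<open>Half of \<open>d\<close> stays inside the neighbourhood of positive velocity, so
    the time \<open>s\<close> with \<open>v s \<le> 0\<close> obtained from \<open>notB\<close> must
    lie before \<open>r\<close>.\<close>
  have "u r < u (r + d / 2)"
    by (rule DERIV_pos_imp_increasing) (use d trajectoryD(3)[OF tr] in \<open>auto intro!: exI d(2)\<close>)
  then obtain s where s: "0 \<le> s" "s \<le> r + d / 2" "a\<^sub>0 \<le> u s" "v s \<le> 0"
    using notB[of "r + d / 2"] d(1) \<open>0 < r\<close> \<open>u r = a\<^sub>1\<close> by force
  have "s < r" using d(1) d(2)[of s] s by force
  have "v s = 0" using nonneg[of s] s \<open>s < r\<close> by simp
  have "s \<noteq> 0" using s(3) less trajectoryD(1)[OF tr] by auto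
  then have "0 < s" using s by simp
  have "k * v s + g (u s) = 0"
  proof (rule DERIV_local_min[OF trajectoryD(4)[OF tr]])
    show "0 < min s (r - s)" using \<open>0 < s\<close> \<open>s < r\<close> by simp
    show "\<forall>y. \<bar>s - y\<bar> < min s (r - s) \<longrightarrow> v s \<le> v y"
      using \<open>v s = 0\<close> nonneg by auto
  qed
  then show False
    using trajectory_avoids_equilibria[OF tr s(1) \<open>v s = 0\<close>] \<open>v s = 0\<close> by simp
qed

section \<open>Connecting trajectories and their limits\<close>

definition connection :: "real \<Rightarrow> (real \<Rightarrow> real) \<Rightarrow> (real \<Rightarrow> real) \<Rightarrow> bool" where
  "connection k u v \<longleftrightarrow> trajectory k u v \<and> (\<forall>t\<ge>0. u t < a\<^sub>1) \<and> (\<forall>t>0. 0 < v t) \<and>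
     (u \<longlongrightarrow> a\<^sub>1) at_top \<and> (v \<longlongrightarrow> 0) at_top"

lemma connectionI:
  assumes tr: "trajectory k u v" and "0 \<le> k"
    and notA: "\<And>t. 0 < t \<Longrightarrow> v t < 0 \<Longrightarrow> \<exists>s\<in>{0..t}. a\<^sub>1 \<le> u s"
    and notB: "\<And>t. 0 < t \<Longrightarrow> a\<^sub>1 < u t \<Longrightarrow> \<exists>s\<in>{0..t}. a\<^sub>0 \<le> u s \<and> v s \<le> 0"
  shows "connection k u v"
proof -
  have u1: "u t < a\<^sub>1" if "0 \<le> t" for t
    using trajectory_stays_below[OF tr that notA notB] .
  have nonneg: "0 \<le> v t" if "0 < t" for t
    using notA[OF that] u1 by force
  have vpos: "0 < v t" if "0 < t" for t
  proof (rule ccontr)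
    assume "\<not> 0 < v t"
    then have "v t = 0" using nonneg[OF that] by simp
    \<comment> \<open>The velocity is nonnegative at all positive times, so a zero of it is an
      interior minimum and the acceleration vanishes there.\<close>
    have "k * v t + g (u t) = 0"
    proof (rule DERIV_local_min[OF trajectoryD(4)[OF tr] that])
      show "\<forall>y. \<bar>t - y\<bar> < t \<longrightarrow> v t \<le> v y"
        using \<open>v t = 0\<close> nonneg by auto
    qed
    then show False
      using trajectory_avoids_equilibria[OF tr _ \<open>v t = 0\<close>] \<open>v t = 0\<close> that by simp
  qed
  have mono: "u s \<le> u t" if "0 \<le> s" "s \<le> t" for s t
    by (rule DERIV_nonneg_imp_increasing_open[OF that(2)])
       (use that trajectoryD[OF tr] vpos in \<open>auto intro!: exI less_imp_le[OF vpos]\<close>)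
  obtain l where l: "(u \<longlongrightarrow> l) at_top" "\<And>t. 0 \<le> t \<Longrightarrow> u t \<le> l" "l \<le> a\<^sub>1"
    using bounded_mono_tendsto_at_top[of 0 u a\<^sub>1] mono u1 by (metis less_imp_le)
  \<comment> \<open>Otherwise the forcing is never negative, \<open>v\<close> is nondecreasing from
    its positive value at time 1, and \<open>u\<close> grows at least linearly, up to
    \<open>a\<^sub>1\<close> in finite time.\<close>
  have "a\<^sub>0 < l"
  proof (rule ccontr)
    assume "\<not> a\<^sub>0 < l"
    then have gnn: "0 \<le> g (u t)" if "0 \<le> t" for t
      using l(2)[OF that] pos[of "u t"] zero by (cases "u t = a\<^sub>0") auto
    have vmono: "v s \<le> v t" if "0 < s" "s \<le> t" for s t
      by (rule DERIV_nonneg_imp_nondecreasing[OF that(2)])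
         (use that \<open>0 \<le> k\<close> in \<open>force intro!: exI[where P="\<lambda>d. _ d \<and> _ d"] trajectoryD(4)[OF tr] add_nonneg_nonneg mult_nonneg_nonneg gnn nonneg\<close>)
    have "u 1 + v 1 * (t - 1) \<le> u t" if "1 \<le> t" for t
    proof -
      have "u 1 - v 1 * 1 \<le> u t - v 1 * t"
      proof (rule DERIV_nonneg_imp_nondecreasing[OF that])
        fix s assume "1 \<le> s" "s \<le> t"
        then show "\<exists>d. ((\<lambda>t. u t - v 1 * t) has_real_derivative d) (at s) \<and> 0 \<le> d"
          by (intro exI[of _ "v s - v 1"]) (auto intro!: derivative_eq_intros trajectoryD(3)[OF tr] vmono)
      qed
      then show ?thesis by (simp add: algebra_simps)
    qed
    from this[of "1 + (a\<^sub>1 - u 1) / v 1"] u1[of 1] vpos[of 1] u1[of "1 + (a\<^sub>1 - u 1) / v 1"]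
    show False by (simp add: divide_nonneg_pos)
  qed
  then have "\<forall>\<^sub>F t in at_top. a\<^sub>0 < u t"
    using l(1) order_tendstoD(1) by blast
  then obtain T where T: "\<And>t. T \<le> t \<Longrightarrow> a\<^sub>0 < u t"
    by (auto simp: eventually_at_top_linorder)
  define T' where "T' = max T 1"
  \<comment> \<open>The derivative of \<open>k * u - v\<close> is \<open>- g u\<close>, positive
    once \<open>u\<close> lies between \<open>a\<^sub>0\<close> and \<open>a\<^sub>1\<close>. Being
    monotone and bounded above, this combination converges, and with it \<open>v\<close>.\<close>
  obtain m where m: "((\<lambda>t. k * u t - v t) \<longlongrightarrow> m) at_top"
  proof (rule bounded_mono_tendsto_at_top)
    fix s t assume "T' \<le> s" "s \<le> t"
    show "k * u s - v s \<le> k * u t - v t"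
    proof (rule DERIV_nonneg_imp_nondecreasing[OF \<open>s \<le> t\<close>])
      fix r assume "s \<le> r" "r \<le> t"
      then have "g (u r) < 0"
        using T[of r] u1[of r] \<open>T' \<le> s\<close> by (intro neg) (auto simp: T'_def)
      then show "\<exists>d. ((\<lambda>t. k * u t - v t) has_real_derivative d) (at r) \<and> 0 \<le> d"
        by (intro exI[of _ "- g (u r)"]) (auto intro!: derivative_eq_intros trajectoryD(3,4)[OF tr])
    qed
  next
    fix t assume "T' \<le> t"
    then show "k * u t - v t \<le> k * a\<^sub>1"
      using u1[of t] vpos[of t] \<open>0 \<le> k\<close> mult_left_mono[of "u t" a\<^sub>1 k] by (simp add: T'_def)
  qed
  have "((\<lambda>t. k * u t - (k * u t - v t)) \<longlongrightarrow> k * l - m) at_top"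
    by (intro tendsto_intros l m)
  then have v_lim: "(v \<longlongrightarrow> k * l - m) at_top" by simp
  have "k * l - m = 0"
    by (rule tendsto_deriv_imp_zero[OF _ l(1) v_lim]) (rule trajectoryD(3)[OF tr])
  then have v0: "(v \<longlongrightarrow> 0) at_top" using v_lim by simp
  \<comment> \<open>The same argument one order higher: the acceleration converges and must tend to
    0, so \<open>l\<close> is a zero of \<open>g\<close> beyond \<open>a\<^sub>0\<close>.\<close>
  have "((\<lambda>t. k * v t + g (u t)) \<longlongrightarrow> k * 0 + g l) at_top"
    by (intro tendsto_intros v0 continuous_on_tendsto_compose[OF continuous_g[of UNIV] l(1)]) auto
  then have "k * 0 + g l = 0"
    using tendsto_deriv_imp_zero[OF trajectoryD(4)[OF tr] v0] by blast
  then have "l = a\<^sub>1"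
    using neg[of l] \<open>a\<^sub>0 < l\<close> l(3) by force
  then show ?thesis
    using l(1) v0 vpos u1 tr by (auto simp: connection_def)
qed

lemma exists_connection: "\<exists>k u v. 0 < k \<and> connection k u v"
proof -
  define K where "K = L + 1"
  have "0 < K" using L_nonneg by (simp add: K_def)
  obtain u v where cu: "continuous_on UNIV (\<lambda>(k, t). u k t)" and cv: "continuous_on UNIV (\<lambda>(k, t). v k t)"
    and tr: "\<And>k. 0 \<le> k \<Longrightarrow> k \<le> K \<Longrightarrow> trajectory k (u k) (v k)"
    using trajectory_family[of K] by blast
  \<comment> \<open>\<open>A\<close> says that the trajectory turns back before meeting
    \<open>a\<^sub>1\<close>; \<open>B\<close> says that it overshoots without having stopped at or
    beyond \<open>a\<^sub>0\<close>. Requiring positive velocity throughout would make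
    \<open>B\<close> empty, because the velocity is 0 at time 0; the disjunct
    \<open>u k s < a\<^sub>0\<close> admits the start and still prevents turning back.\<close>
  define A where "A = {k. \<exists>t>0. v k t < 0 \<and> (\<forall>s\<in>{0..t}. u k s < a\<^sub>1)}"
  define B where "B = {k. \<exists>t>0. a\<^sub>1 < u k t \<and> (\<forall>s\<in>{0..t}. u k s < a\<^sub>0 \<or> 0 < v k s)}"
  have cont: "continuous_on S (\<lambda>k. u k t)" "continuous_on S (\<lambda>k. v k t)" for S t
    using continuous_on_compose2[OF cu, of S "\<lambda>k. (k, t)"] continuous_on_compose2[OF cv, of S "\<lambda>k. (k, t)"]
    by (simp_all add: continuous_intros)
  have "open A"
  proof -
    have "open {z. u (fst z) (snd z) < a\<^sub>1}"
      using open_Collect_less[OF cu continuous_on_const[of UNIV a\<^sub>1]] by (simp add: case_prod_beta)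
    from open_forall_compact[OF compact_Icc this]
    have "open {k. \<forall>s\<in>{0..t}. u k s < a\<^sub>1}" for t
      by simp
    moreover have "A = (\<Union>t\<in>{0<..}. {k. v k t < 0} \<inter> {k. \<forall>s\<in>{0..t}. u k s < a\<^sub>1})"
      by (auto simp: A_def)
    ultimately show ?thesis
      by (auto intro!: open_UN open_Int open_Collect_less cont)
  qed
  have "open B"
  proof -
    have "open ({z. u (fst z) (snd z) < a\<^sub>0} \<union> {z. 0 < v (fst z) (snd z)})"
      using open_Collect_less[OF cu continuous_on_const[of UNIV a\<^sub>0]]
        open_Collect_less[OF continuous_on_const[of UNIV 0] cv] by (simp add: case_prod_beta open_Un)
    from open_forall_compact[OF compact_Icc this]
    have "open {k. \<forall>s\<in>{0..t}. u k s < a\<^sub>0 \<or> 0 < v k s}" for t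
      by simp
    moreover have "B = (\<Union>t\<in>{0<..}. {k. a\<^sub>1 < u k t} \<inter> {k. \<forall>s\<in>{0..t}. u k s < a\<^sub>0 \<or> 0 < v k s})"
      by (auto simp: B_def)
    ultimately show ?thesis
      by (auto intro!: open_UN open_Int open_Collect_less cont)
  qed
  have disj: "A \<inter> B \<inter> {0..K} = {}"
  proof -
    have False if "k \<in> A" "k \<in> B" "0 \<le> k" "k \<le> K" for k
    proof -
      obtain s t where s: "0 < s" "v k s < 0" "\<And>r. r \<in> {0..s} \<Longrightarrow> u k r < a\<^sub>1"
        and t: "0 < t" "a\<^sub>1 < u k t" "\<And>r. r \<in> {0..t} \<Longrightarrow> u k r < a\<^sub>0 \<or> 0 < v k r"
        using \<open>k \<in> A\<close> \<open>k \<in> B\<close> unfolding A_def B_def by blast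
      \<comment> \<open>If the turning time comes first, the condition in \<open>B\<close> makes the
        velocity nonnegative there; if the overshoot comes first, it contradicts the bound by
        \<open>a\<^sub>1\<close> in \<open>A\<close>.\<close>
      show False
      proof (cases "s \<le> t")
        case True
        then show False
          using velocity_nonneg_while_forced[OF tr[OF that(3,4)], of s] s t(3) by force
      next
        case False
        then show False using s(3)[of t] t by auto
      qed
    qed
    then show ?thesis by auto
  qed
  have "0 \<notin> B"
  proof
    assume "0 \<in> B"
    then obtain t where t: "0 < t" "a\<^sub>1 < u 0 t" unfolding B_def by blast
    have tr0: "trajectory 0 (u 0) (v 0)" using tr \<open>0 < K\<close> by simp
    obtain s where s: "u 0 s = a\<^sub>1"
      using IVT'[of "u 0" 0 a\<^sub>1 t] t less trajectoryD[OF tr0] by auto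
    obtain G where "G a\<^sub>1 < 0" "(v 0 s)\<^sup>2 / 2 = G (u 0 s)"
      using energy[OF tr0] by metis
    then show False using s zero_le_power2[of "v 0 s"] by simp
  qed
  moreover have "K \<notin> A"
  proof -
    have "trajectory (L + 1) (u K) (v K)"
      using tr[of K] \<open>0 < K\<close> by (simp add: K_def)
    then have "\<not> v K t < 0" if "0 < t" for t
      using velocity_nonneg_fast[of "u K" "v K" t] that by simp
    then show ?thesis
      unfolding A_def by blast
  qed
  \<comment> \<open>Were the interval covered by \<open>A\<close> and \<open>B\<close>, then 0 would
    lie in \<open>A\<close> and \<open>K\<close> in \<open>B\<close>, and the two open sets would
    disconnect it.\<close>
  ultimately have "\<exists>k\<in>{0..K}. k \<notin> A \<and> k \<notin> B"
    using connectedD[OF connected_Icc[of 0 K] \<open>open A\<close> \<open>open B\<close> disj] \<open>0 < K\<close> by fastforce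
  then obtain k where k: "0 \<le> k" "k \<le> K" "k \<notin> A" "k \<notin> B" by auto
  have conn: "connection k (u k) (v k)"
  proof (rule connectionI[OF tr[OF k(1,2)] k(1)])
    fix t :: real
    assume "0 < t"
    show "\<exists>s\<in>{0..t}. a\<^sub>1 \<le> u k s" if "v k t < 0"
    proof (rule ccontr)
      assume "\<not> ?thesis"
      then have "\<forall>s\<in>{0..t}. u k s < a\<^sub>1" by (auto simp: not_le)
      with \<open>0 < t\<close> that \<open>k \<notin> A\<close> show False unfolding A_def by blast
    qed
    show "\<exists>s\<in>{0..t}. a\<^sub>0 \<le> u k s \<and> v k s \<le> 0" if "a\<^sub>1 < u k t"
    proof (rule ccontr)
      assume "\<not> ?thesis"
      then have "\<forall>s\<in>{0..t}. u k s < a\<^sub>0 \<or> 0 < v k s" by (auto simp: not_le)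
      with \<open>0 < t\<close> that \<open>k \<notin> B\<close> show False unfolding B_def by blast
    qed
  qed
  \<comment> \<open>At speed 0 the kinetic term would tend both to 0 and to
    \<open>G a\<^sub>1 < 0\<close>. This gives the strict inequality \<open>c < 0\<close>.\<close>
  have "k \<noteq> 0"
  proof
    assume "k = 0"
    with conn have c: "trajectory 0 (u 0) (v 0)" "(u 0 \<longlongrightarrow> a\<^sub>1) at_top" "(v 0 \<longlongrightarrow> 0) at_top"
      by (auto simp: connection_def)
    obtain G where G: "continuous_on UNIV G" "G a\<^sub>1 < 0" "\<And>t. (v 0 t)\<^sup>2 / 2 = G (u 0 t)"
      using energy[OF c(1)] by metis
    have "((\<lambda>t. (v 0 t)\<^sup>2 / 2) \<longlongrightarrow> 0\<^sup>2 / 2) at_top"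
      by (intro tendsto_intros c) simp
    moreover have "((\<lambda>t. (v 0 t)\<^sup>2 / 2) \<longlongrightarrow> G a\<^sub>1) at_top"
      unfolding G(3) by (rule continuous_on_tendsto_compose[OF G(1) c(2)]) auto
    ultimately show False
      using G(2) tendsto_unique[OF trivial_limit_at_top_linorder] by fastforce
  qed
  with k(1) have "0 < k" by simp
  with conn show ?thesis by blast
qed

end

section \<open>Weak derivatives\<close>

lemma bounded_set_integrable_compact:
  fixes h :: "real \<Rightarrow> real"
  assumes "h \<in> borel_measurable borel" "\<And>x. \<bar>h x\<bar> \<le> B" "compact K"
  shows "set_integrable lebesgue K h"
  unfolding set_integrable_def
proof (rule Bochner_Integration.integrable_bound)
  have K: "K \<in> sets borel" "K \<in> lmeasurable"
    using \<open>compact K\<close> by (simp_all add: borel_compact lmeasurable_compact)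
  show "integrable lebesgue (\<lambda>x. B * indicat_real K x)"
    using K(2) by (intro integrable_mult_right) (simp add: lmeasurable_iff_integrable)
  have "(\<lambda>x. indicat_real K x *\<^sub>R h x) \<in> borel_measurable lborel"
    using assms(1) K(1) by simp
  then show "(\<lambda>x. indicat_real K x *\<^sub>R h x) \<in> borel_measurable lebesgue"
    by (rule measurable_completion)
  show "AE x in lebesgue. norm (indicat_real K x *\<^sub>R h x) \<le> norm (B * indicat_real K x)"
    by (rule AE_I2) (use assms(2) abs_ge_self order_trans in \<open>fastforce simp: indicator_def\<close>)
qed

lemma bounded_integrable_compact_support:
  fixes h :: "real \<Rightarrow> real"
  assumes "h \<in> borel_measurable borel" "\<And>x. \<bar>h x\<bar> \<le> B" "compact K" "\<And>x. x \<notin> K \<Longrightarrow> h x = 0"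
  shows "integrable lebesgue h"
proof -
  have "(\<lambda>x. indicat_real K x *\<^sub>R h x) = h"
    using assms(4) by (auto simp: indicator_def fun_eq_iff)
  then show ?thesis
    using bounded_set_integrable_compact[OF assms(1-3)] by (simp add: set_integrable_def)
qed

lemma L_infty_bounded:
  assumes "h \<in> borel_measurable borel" "\<And>x. \<bar>h x\<bar> \<le> B"
  shows "L_infty h"
  unfolding L_infty_def using assms by (auto intro: measurable_completion)

lemma L1_loc_bounded:
  assumes "h \<in> borel_measurable borel" "\<And>x. \<bar>h x\<bar> \<le> B"
  shows "L1_loc h"
  unfolding L1_loc_def using bounded_set_integrable_compact assms by blast

text \<open>The second weak derivative comes from two integrations by parts, the first of them
  against the derivative of the test function.\<close>

lemma test_function_deriv:
  assumes "test_function \<psi>"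
  shows "test_function (deriv \<psi>)"
proof -
  let ?K = "closure {x. \<psi> x \<noteq> 0}"
  have "deriv \<psi> x = 0" if "x \<notin> ?K" for x
  proof -
    have "(\<psi> has_real_derivative 0) (at x)"
    proof (rule has_field_derivative_transform_within_open[of "\<lambda>_. 0"])
      show "open (- ?K)" by (simp add: open_Compl)
      show "0 = \<psi> y" if "y \<in> - ?K" for y
        using that closure_subset[of "{x. \<psi> x \<noteq> 0}"] by auto
    qed (use that in auto)
    then show ?thesis by (rule DERIV_imp_deriv)
  qed
  then have "{x. deriv \<psi> x \<noteq> 0} \<subseteq> ?K" by auto
  then have "closure {x. deriv \<psi> x \<noteq> 0} \<subseteq> ?K"
    by (simp add: closure_minimal)
  moreover have "compact ?K" using assms by (simp add: test_function_def)
  ultimately have "compact (closure {x. deriv \<psi> x \<noteq> 0})"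
    using bounded_subset by (auto simp: compact_eq_bounded_closed)
  moreover have "(deriv ^^ n) (deriv \<psi>) differentiable_on UNIV" for n
    using assms unfolding test_function_def by (metis funpow_Suc_right o_apply)
  ultimately show ?thesis by (simp add: test_function_def)
qed

lemma test_functionD:
  assumes "test_function \<psi>"
  shows "(\<psi> has_real_derivative deriv \<psi> x) (at x)" "continuous_on S \<psi>"
proof -
  have d: "\<psi> differentiable at x" for x
    using assms[unfolded test_function_def, THEN conjunct1, rule_format, of 0]
    by (simp add: differentiable_on_def)
  then show "(\<psi> has_real_derivative deriv \<psi> x) (at x)"
    by (simp add: DERIV_deriv_iff_real_differentiable)
  show "continuous_on S \<psi>"
    using d by (auto intro: continuous_at_imp_continuous_on differentiable_imp_continuous_within)
qed

text \<open>The exceptional point \<open>p\<close> accommodates the corner of \<open>V\<close> at 0.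
  Continuity across it suffices for the fundamental theorem, and outside the supports the boundary
  terms vanish.\<close>

lemma integral_by_parts_test_function:
  assumes u: "continuous_on UNIV u" "\<And>x. x \<noteq> p \<Longrightarrow> (u has_real_derivative w x) (at x)"
    and w: "w \<in> borel_measurable borel" "\<And>x. \<bar>w x\<bar> \<le> B"
    and \<psi>: "test_function \<psi>"
  shows "(LINT x|lebesgue. u x * deriv \<psi> x) = - (LINT x|lebesgue. w x * \<psi> x)"
proof -
  let ?K = "closure {x. \<psi> x \<noteq> 0} \<union> closure {x. deriv \<psi> x \<noteq> 0}"
  note \<psi>' = test_function_deriv[OF \<psi>]
  have K: "compact ?K"
    using \<psi> \<psi>' by (auto simp: test_function_def)
  have zero: "\<psi> x = 0" "deriv \<psi> x = 0" if "x \<notin> ?K" for x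
    using that closure_subset[of "{x. \<psi> x \<noteq> 0}"] closure_subset[of "{x. deriv \<psi> x \<noteq> 0}"] by auto
  obtain R where "R > 0" and R: "\<And>x. x \<in> ?K \<Longrightarrow> \<bar>x\<bar> < R"
    using compact_imp_bounded[OF K] unfolding bounded_pos_less by auto
  have bdd: "\<exists>C. \<forall>x. \<bar>y x\<bar> \<le> C" if "continuous_on UNIV y" "\<And>x. x \<notin> ?K \<Longrightarrow> y x = 0" for y :: "real \<Rightarrow> real"
  proof -
    have "bounded (y ` ?K)"
      using K that(1) by (intro compact_imp_bounded compact_continuous_image continuous_on_subset[OF that(1)]) auto
    then obtain C where "\<And>x. x \<in> ?K \<Longrightarrow> \<bar>y x\<bar> \<le> C" "C > 0"
      unfolding bounded_pos by auto
    then show ?thesis using that(2) by (metis abs_0 less_imp_le)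
  qed
  have c\<psi>: "continuous_on UNIV \<psi>" and c: "continuous_on UNIV (\<lambda>x. u x * deriv \<psi> x)"
    using test_functionD(2)[OF \<psi>] test_functionD(2)[OF \<psi>'] u(1) by (auto intro: continuous_intros)
  obtain C where C: "\<And>x. \<bar>\<psi> x\<bar> \<le> C"
    using bdd[OF c\<psi> zero(1)] by metis
  have zero': "u x * deriv \<psi> x = 0" if "x \<notin> ?K" for x
    using zero(2)[OF that] by simp
  obtain C' where C': "\<And>x. \<bar>u x * deriv \<psi> x\<bar> \<le> C'"
    using bdd[OF c zero'] by metis
  have i1: "integrable lebesgue (\<lambda>x. u x * deriv \<psi> x)"
    by (rule bounded_integrable_compact_support[OF borel_measurable_continuous_onI[OF c] C' K zero'])
  have i2: "integrable lebesgue (\<lambda>x. w x * \<psi> x)"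
  proof (rule bounded_integrable_compact_support[OF _ _ K])
    show "(\<lambda>x. w x * \<psi> x) \<in> borel_measurable borel"
      using w(1) borel_measurable_continuous_onI[OF c\<psi>] by simp
    show "\<bar>w x * \<psi> x\<bar> \<le> B * C" for x
      using mult_mono[OF w(2)[of x] C[of x]] w(2)[of x] by (simp add: abs_mult)
    show "w x * \<psi> x = 0" if "x \<notin> ?K" for x
      using zero(1)[OF that] by simp
  qed
  let ?h = "\<lambda>x. w x * \<psi> x + u x * deriv \<psi> x"
  have "(?h has_integral u R * \<psi> R - u (- R) * \<psi> (- R)) {- R..R}"
  proof (rule fundamental_theorem_of_calculus_interior_strong[of "{p}"])
    fix x assume "x \<in> {- R<..<R} - {p}"
    then show "((\<lambda>x. u x * \<psi> x) has_vector_derivative ?h x) (at x)"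
      unfolding has_real_derivative_iff_has_vector_derivative[symmetric]
      by (auto intro!: derivative_eq_intros u(2) test_functionD(1)[OF \<psi>])
  next
    show "continuous_on {- R..R} (\<lambda>x. u x * \<psi> x)"
      by (intro continuous_intros test_functionD(2)[OF \<psi>] continuous_on_subset[OF u(1)]) auto
  qed (use \<open>R > 0\<close> in auto)
  moreover have far: "\<psi> x = 0" "?h x = 0" if "R \<le> \<bar>x\<bar>" for x
  proof -
    have "x \<notin> ?K" using R[of x] that by linarith
    from zero[OF this] show "\<psi> x = 0" "?h x = 0" by simp_all
  qed
  ultimately have "(?h has_integral 0) {- R..R}" using \<open>R > 0\<close> by simp
  then have "(?h has_integral 0) UNIV"
    by (rule has_integral_on_superset) (use far(2) in force)+
  moreover have "(?h has_integral (LINT x|lebesgue. ?h x)) UNIV"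
    by (intro has_integral_integral_lebesgue Bochner_Integration.integrable_add i1 i2)
  ultimately have "(LINT x|lebesgue. ?h x) = 0"
    by (rule has_integral_unique[rotated])
  then show ?thesis
    by (simp add: Bochner_Integration.integral_add[OF i2 i1])
qed

section \<open>The wave profile\<close>

text \<open>Agreement between \<alpha> and \<open>a\<^sub>1\<close> is enough to pass from
  \<open>g\<close> to \<open>f\<close>, because the profile takes no other values.\<close>

locale wave_profile = shooting +
  fixes k :: real and u v f :: "real \<Rightarrow> real"
  assumes k: "0 < k" and conn: "connection k u v"
    and agree: "\<And>x. \<alpha> \<le> x \<Longrightarrow> x \<le> a\<^sub>1 \<Longrightarrow> f x = g x"
begin

text \<open>The gluing is continuously differentiable because \<open>u 0 = \<alpha>\<close> and
  \<open>v 0 = 0\<close>. The second derivative \<open>W\<close> jumps at 0 from 0 to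
  \<open>g \<alpha> > 0\<close>; its value at that single point is a convention.\<close>

definition \<phi> :: "real \<Rightarrow> real" where "\<phi> s = (if s \<le> 0 then \<alpha> else u s)"
definition V :: "real \<Rightarrow> real" where "V s = (if s \<le> 0 then 0 else v s)"
definition W :: "real \<Rightarrow> real" where "W s = (if s \<le> 0 then 0 else k * v s + g (u s))"

lemma tr: "trajectory k u v"
  using conn by (simp add: connection_def)

lemma \<phi>_deriv: "(\<phi> has_real_derivative V s) (at s)"
proof -
  consider "s < 0" | "s = 0" | "s > 0" by linarith
  then show ?thesis
  proof cases
    case 1
    have "(\<phi> has_real_derivative 0) (at s)"
      by (rule has_field_derivative_transform_within_open[of "\<lambda>_. \<alpha>" _ _ "{..<0}"])
         (use 1 in \<open>auto simp: \<phi>_def\<close>)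
    then show ?thesis using 1 by (simp add: V_def)
  next
    case 2
    have "(\<phi> has_real_derivative 0) (at 0 within {..0})"
      by (rule has_field_derivative_transform_within[of "\<lambda>_. \<alpha>" _ _ _ 1]) (auto simp: \<phi>_def)
    moreover have "(u has_real_derivative 0) (at 0 within {0..})"
      using trajectoryD(3)[OF tr, of 0] trajectoryD(2)[OF tr] by (simp add: has_field_derivative_at_within)
    then have "(\<phi> has_real_derivative 0) (at 0 within {0..})"
      by (rule has_field_derivative_transform_within[of _ _ _ _ 1])
         (use trajectoryD(1)[OF tr] in \<open>auto simp: \<phi>_def\<close>)
    ultimately have "(\<phi> has_real_derivative 0) (at 0 within {..0} \<union> {0..})"
      unfolding has_field_derivative_iff unfolding at_within_union by (rule filterlim_sup)
    moreover have "{..0} \<union> {0..} = (UNIV :: real set)" by auto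
    ultimately show ?thesis using 2 by (simp add: V_def)
  next
    case 3
    have "(\<phi> has_real_derivative v s) (at s)"
      by (rule has_field_derivative_transform_within_open[OF trajectoryD(3)[OF tr], where S="{0<..}"])
         (use 3 in \<open>auto simp: \<phi>_def\<close>)
    then show ?thesis using 3 by (simp add: V_def)
  qed
qed

lemma V_deriv:
  assumes "s \<noteq> 0"
  shows "(V has_real_derivative W s) (at s)"
proof (cases "s < 0")
  case True
  have "(V has_real_derivative 0) (at s)"
    by (rule has_field_derivative_transform_within_open[of "\<lambda>_. 0" _ _ "{..<0}"])
       (use True in \<open>auto simp: V_def\<close>)
  then show ?thesis using True by (simp add: W_def)
next
  case False
  have "(V has_real_derivative k * v s + g (u s)) (at s)"
    by (rule has_field_derivative_transform_within_open[OF trajectoryD(4)[OF tr], where S="{0<..}"])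
       (use False assms in \<open>auto simp: V_def\<close>)
  then show ?thesis using False assms by (simp add: W_def)
qed

lemma deriv_\<phi>: "deriv \<phi> = V"
  using \<phi>_deriv by (intro ext DERIV_imp_deriv)

lemma deriv_V: "s \<noteq> 0 \<Longrightarrow> deriv V s = W s"
  by (rule DERIV_imp_deriv[OF V_deriv])

lemma V_pos: "0 < s \<Longrightarrow> 0 < V s" and V_nonneg: "0 \<le> V s" and V_left: "s \<le> 0 \<Longrightarrow> V s = 0"
  using conn by (auto simp: V_def connection_def less_imp_le)

lemma \<phi>_gt:
  assumes "0 < s"
  shows "\<alpha> < \<phi> s"
proof -
  have "\<exists>y. (u has_real_derivative y) (at x) \<and> 0 < y" if "0 < x" for x
    using trajectoryD(3)[OF tr, of x] conn that by (auto simp: connection_def)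
  then have "u 0 < u s"
    using assms by (intro DERIV_pos_imp_increasing_open[of 0 s u] trajectoryD(7)[OF tr]) auto
  then show ?thesis
    using assms trajectoryD(1)[OF tr] by (simp add: \<phi>_def)
qed

lemma \<phi>_left: "s \<le> 0 \<Longrightarrow> \<phi> s = \<alpha>"
  by (simp add: \<phi>_def)

lemma \<phi>_bounds: "\<alpha> \<le> \<phi> s" "\<phi> s < a\<^sub>1"
  using \<phi>_gt[of s] conn less by (cases "s \<le> 0"; force simp: \<phi>_def connection_def)+

lemma f_\<phi>: "f (\<phi> s) = g (\<phi> s)"
  using \<phi>_bounds[of s] by (intro agree) auto

lemma continuous_\<phi>: "continuous_on S \<phi>"
  using \<phi>_deriv by (auto intro: continuous_at_imp_continuous_on DERIV_isCont)

lemma continuous_V: "continuous_on S V"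
proof -
  have "V = (\<lambda>s. v (max s 0))"
    using trajectoryD(2)[OF tr] by (auto simp: V_def max_def)
  then show ?thesis
    by (auto intro!: continuous_intros continuous_on_compose2[OF trajectoryD(8)[OF tr, of UNIV]])
qed

lemma \<phi>_limits: "(\<phi> \<longlongrightarrow> \<alpha>) at_bot" "(\<phi> \<longlongrightarrow> a\<^sub>1) at_top"
proof -
  show "(\<phi> \<longlongrightarrow> \<alpha>) at_bot"
    by (rule tendsto_eventually) (use eventually_le_at_bot[of 0] in \<open>eventually_elim, simp add: \<phi>_left\<close>)
  have "(u \<longlongrightarrow> a\<^sub>1) at_top" using conn by (simp add: connection_def)
  then show "(\<phi> \<longlongrightarrow> a\<^sub>1) at_top"
    by (rule Lim_transform_eventually)
       (rule eventually_mono[OF eventually_gt_at_top[of 0]], simp add: \<phi>_def)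
qed

lemma V_limits: "(V \<longlongrightarrow> 0) at_bot" "(V \<longlongrightarrow> 0) at_top"
proof -
  show "(V \<longlongrightarrow> 0) at_bot"
    by (rule tendsto_eventually) (use eventually_le_at_bot[of 0] in \<open>eventually_elim, simp add: V_left\<close>)
  have "(v \<longlongrightarrow> 0) at_top" using conn by (simp add: connection_def)
  then show "(V \<longlongrightarrow> 0) at_top"
    by (rule Lim_transform_eventually)
       (rule eventually_mono[OF eventually_gt_at_top[of 0]], simp add: V_def)
qed

lemma V_bounded: obtains C where "0 < C" "\<And>s. V s \<le> C"
proof -
  have "\<forall>\<^sub>F s in at_top. V s < 1"
    using V_limits(2) by (rule order_tendstoD) simp
  then obtain T where T: "\<And>s. T \<le> s \<Longrightarrow> V s < 1"
    by (auto simp: eventually_at_top_linorder)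
  have "bounded (V ` {0..T})"
    by (intro compact_imp_bounded compact_continuous_image continuous_V) simp
  then obtain C where C: "\<forall>s\<in>{0..T}. \<bar>V s\<bar> \<le> C"
    unfolding bounded_iff by auto
  have "V s \<le> max C 1" for s
    using T[of s] C[rule_format, of s] V_left[of s] by (cases "s \<le> 0"; cases "T \<le> s") auto
  then show thesis by (intro that[of "max C 1"]) auto
qed

section \<open>Sobolev regularity and square integrability\<close>

lemma \<phi>_measurable: "\<phi> \<in> borel_measurable borel" and V_measurable: "V \<in> borel_measurable borel"
  by (intro borel_measurable_continuous_onI continuous_\<phi> continuous_V)+

lemma W_measurable: "W \<in> borel_measurable borel"
proof -
  have "(\<lambda>s. k * v s + g (u s)) \<in> borel_measurable borel"
    by (intro borel_measurable_continuous_onI continuous_intros trajectoryD[OF tr]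
        continuous_on_compose2[OF continuous_g[of UNIV]]) auto
  then show ?thesis
    unfolding W_def by measurable
qed

lemma bounded_\<phi>VW: obtains B where "\<And>s. \<bar>\<phi> s\<bar> \<le> B" "\<And>s. \<bar>V s\<bar> \<le> B" "\<And>s. \<bar>W s\<bar> \<le> B"
proof -
  obtain C where C: "0 < C" "\<And>s. V s \<le> C" using V_bounded by blast
  have "bounded (g ` {\<alpha>..a\<^sub>1})"
    by (intro compact_imp_bounded compact_continuous_image continuous_g) simp
  then obtain D where D: "\<forall>x\<in>{\<alpha>..a\<^sub>1}. \<bar>g x\<bar> \<le> D"
    unfolding bounded_iff by auto
  have D': "\<bar>g (\<phi> s)\<bar> \<le> D" for s
    using \<phi>_bounds[of s] by (intro D[rule_format]) auto
  define B where "B = \<bar>\<alpha>\<bar> + \<bar>a\<^sub>1\<bar> + C + k * C + D"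
  have nn: "0 \<le> k * C" "0 \<le> D"
    using C(1) k D'[of 0] by auto
  have "\<bar>W s\<bar> \<le> B" for s
  proof (cases "s \<le> 0")
    case True
    then show ?thesis using nn C(1) by (simp add: W_def B_def)
  next
    case False
    then have "W s = k * V s + g (\<phi> s)" by (simp add: W_def V_def \<phi>_def)
    moreover have "k * V s \<le> k * C" "0 \<le> k * V s"
      using C(2)[of s] V_nonneg[of s] k by auto
    ultimately show ?thesis using D'[of s] C(1) unfolding B_def by linarith
  qed
  moreover have "\<bar>\<phi> s\<bar> \<le> B" for s
    using \<phi>_bounds[of s] nn C(1) unfolding B_def by linarith
  moreover have "\<bar>V s\<bar> \<le> B" for s
    using V_nonneg[of s] C(2)[of s] nn unfolding B_def by linarith
  ultimately show thesis using that by blast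
qed

lemma W_infty_\<phi>: "W_infty 2 \<phi>"
proof -
  obtain B where B: "\<And>s. \<bar>\<phi> s\<bar> \<le> B" "\<And>s. \<bar>V s\<bar> \<le> B" "\<And>s. \<bar>W s\<bar> \<le> B"
    using bounded_\<phi>VW by blast
  note L = L_infty_bounded[OF \<phi>_measurable B(1)] L_infty_bounded[OF V_measurable B(2)]
    L_infty_bounded[OF W_measurable B(3)]
  note L1 = L1_loc_bounded[OF \<phi>_measurable B(1)] L1_loc_bounded[OF V_measurable B(2)]
    L1_loc_bounded[OF W_measurable B(3)]
  have p1: "(LINT x|lebesgue. \<phi> x * deriv \<psi> x) = - (LINT x|lebesgue. V x * \<psi> x)"
    if "test_function \<psi>" for \<psi>
    by (rule integral_by_parts_test_function[OF continuous_\<phi> \<phi>_deriv V_measurable B(2) that])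
  have p2: "(LINT x|lebesgue. V x * deriv \<psi> x) = - (LINT x|lebesgue. W x * \<psi> x)"
    if "test_function \<psi>" for \<psi>
    by (rule integral_by_parts_test_function[OF continuous_V V_deriv W_measurable B(3) that])
  have "weak_derivative 1 \<phi> V"
    unfolding weak_derivative_def using L1 p1 by simp
  moreover have "weak_derivative 2 \<phi> W"
    unfolding weak_derivative_def using L1 p1 p2 test_function_deriv by (simp add: numeral_2_eq_2)
  moreover have "{1..2} = {1, 2 :: nat}" by auto
  ultimately show ?thesis
    unfolding W_infty_def using L by auto
qed

text \<open>\<open>V\<close> is nonnegative and its antiderivative \<phi> has finite limits at both
  ends, so \<open>V\<close> is integrable; its square is at most a constant times
  \<open>V\<close>.\<close>

lemma L2_V: "L2 V"
proof -
  obtain C where C: "0 < C" "\<And>s. V s \<le> C" using V_bounded by blast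
  have m: "V \<in> borel_measurable lebesgue"
    using V_measurable by (auto intro: measurable_completion)
  have "set_integrable lborel (einterval (-\<infinity>) \<infinity>) V"
  proof (rule interval_integral_FTC_nonneg)
    show "isCont V x" for x
      using continuous_V[of UNIV] by (simp add: continuous_on_eq_continuous_at)
    show "((\<phi> \<circ> real_of_ereal) \<longlongrightarrow> \<alpha>) (at_right (-\<infinity>))" "((\<phi> \<circ> real_of_ereal) \<longlongrightarrow> a\<^sub>1) (at_left \<infinity>)"
      using \<phi>_limits by (simp_all add: ereal_tendsto_simps)
  qed (auto simp: \<phi>_deriv V_nonneg)
  then have "integrable lborel V"
    by (simp add: set_integrable_def)
  then have "integrable lebesgue V"
    using V_measurable by (simp add: integrable_completion)
  then have "integrable lebesgue (\<lambda>s. (V s)\<^sup>2)"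
  proof (rule Bochner_Integration.integrable_bound[OF integrable_mult_right[of C]])
    show "AE s in lebesgue. norm ((V s)\<^sup>2) \<le> norm (C * V s)"
      using C V_nonneg by (auto simp: power2_eq_square abs_mult intro!: mult_right_mono)
  qed (use m in auto)
  then show ?thesis using m by (simp add: L2_def)
qed

section \<open>The equations satisfied by the profile and the wave\<close>

lemma profile_equation:
  assumes "s \<noteq> 0"
  shows "k * V s = max (W s - f (\<phi> s)) 0"
proof (cases "s < 0")
  case True
  then show ?thesis
    using pos[of \<alpha>] less f_\<phi>[of s] by (simp add: V_def W_def \<phi>_def)
next
  case False
  then have "W s - f (\<phi> s) = k * V s"
    using assms f_\<phi>[of s] by (simp add: V_def W_def \<phi>_def)
  then show ?thesis using V_nonneg[of s] k by simp
qed

lemma AE_nonzero: "AE s in lebesgue. s \<noteq> (0 :: real)"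
  using AE_not_in[of "{0}" lebesgue] by (simp add: negligible_iff_null_sets[symmetric])

lemma profile_solves_profile: "solves_profile f (- k) \<phi>"
  unfolding solves_profile_def deriv_\<phi>
proof (intro conjI allI)
  show "\<phi> differentiable at s" for s
    using \<phi>_deriv real_differentiable_def by blast
  show "AE s in lebesgue. V differentiable at s \<and> - (- k) * V s = max (deriv V s - f (\<phi> s)) 0"
    using AE_nonzero
    by (rule AE_mp) (auto simp: deriv_V profile_equation real_differentiable_def intro: V_deriv)
qed

lemma profile_solves_obstacle_inclusion: "solves_obstacle_inclusion f \<alpha> (- k) \<phi>"
  unfolding solves_obstacle_inclusion_def deriv_\<phi>
proof (intro conjI allI)
  show "\<phi> differentiable at s" for s
    using \<phi>_deriv real_differentiable_def by blast
  have "0 \<in> (\<lambda>\<eta>. - (- k) * V s - W s + \<eta> + f (\<phi> s)) ` subdifferential (convex_indicator {\<alpha>..}) (\<phi> s)"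
    if "s \<noteq> 0" for s
  proof (cases "s < 0")
    \<comment> \<open>On the contact set both derivatives vanish, so the multiplier has to be
      \<open>- f \<alpha>\<close>; it is admissible because \<open>f \<alpha> > 0\<close>. Off the
      contact set the multiplier is 0.\<close>
    case True
    then show ?thesis
      using pos[of \<alpha>] less f_\<phi>[of s]
      by (auto simp: subdifferential_convex_indicator V_def W_def \<phi>_def intro!: image_eqI[of _ _ "- g \<alpha>"])
  next
    case False
    then show ?thesis
      using that f_\<phi>[of s] \<phi>_gt[of s]
      by (auto simp: subdifferential_convex_indicator V_def W_def \<phi>_def)
  qed
  then have "V differentiable at s \<and>
      0 \<in> (\<lambda>\<eta>. - (- k) * V s - deriv V s + \<eta> + f (\<phi> s)) ` subdifferential (convex_indicator {\<alpha>..}) (\<phi> s)"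
    if "s \<noteq> 0" for s
    unfolding deriv_V[OF that] using that V_deriv real_differentiable_def by blast
  then show "AE s in lebesgue. V differentiable at s \<and>
      0 \<in> (\<lambda>\<eta>. - (- k) * V s - deriv V s + \<eta> + f (\<phi> s)) ` subdifferential (convex_indicator {\<alpha>..}) (\<phi> s)"
    using AE_nonzero by (auto elim: eventually_mono simp del: image_iff)
qed

lemma profile_solves_irreversible_AC: "solves_irreversible_AC f (\<lambda>x t. \<phi> (x - (- k) * t))"
proof -
  have dx: "((\<lambda>y. \<phi> (y - (- k) * t)) has_real_derivative V (x - (- k) * t)) (at x)" for x t
    by (rule DERIV_cong[OF DERIV_chain2[OF \<phi>_deriv]]) (auto intro!: derivative_eq_intros)
  have dt: "((\<lambda>t. \<phi> (x - (- k) * t)) has_real_derivative k * V (x - (- k) * t)) (at t)" for x t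
    by (rule DERIV_cong[OF DERIV_chain2[OF \<phi>_deriv]]) (auto intro!: derivative_eq_intros)
  have dxx: "((\<lambda>y. V (y - (- k) * t)) has_real_derivative W (x - (- k) * t)) (at x)"
    if "x - (- k) * t \<noteq> 0" for x t
    by (rule DERIV_cong[OF DERIV_chain2[where f = V and g = "\<lambda>y :: real. y - (- k) * t" and x = x,
            OF V_deriv[OF that]]]) (auto intro!: derivative_eq_intros)
  have ddx: "deriv (\<lambda>y. \<phi> (y - (- k) * t)) = (\<lambda>x. V (x - (- k) * t))" for t
    by (intro ext DERIV_imp_deriv dx)
  \<comment> \<open>The second space derivative fails to exist only on the path of the free
    boundary, the line \<open>x + k * t = 0\<close>, which has measure zero in the plane.\<close>
  have "negligible {z :: real \<times> real. (1, k) \<bullet> z = 0}"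
    by (rule negligible_hyperplane) (simp add: zero_prod_def)
  then have "AE z in lebesgue. z \<notin> {z :: real \<times> real. (1, k) \<bullet> z = 0}"
    by (intro AE_not_in) (simp add: negligible_iff_null_sets)
  then have "AE (x, t) in lebesgue. deriv (\<lambda>y. \<phi> (y - (- k) * t)) differentiable (at x) \<and>
      deriv (\<lambda>t. \<phi> (x - (- k) * t)) t
        = max (deriv (deriv (\<lambda>y. \<phi> (y - (- k) * t))) x - f (\<phi> (x - (- k) * t))) 0"
  proof (rule eventually_mono)
    fix z :: "real \<times> real"
    assume z: "z \<notin> {z. (1, k) \<bullet> z = 0}"
    have main: "deriv (\<lambda>y. \<phi> (y - (- k) * t)) differentiable (at x) \<and>
      deriv (\<lambda>t. \<phi> (x - (- k) * t)) t
        = max (deriv (deriv (\<lambda>y. \<phi> (y - (- k) * t))) x - f (\<phi> (x - (- k) * t))) 0"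
      if nz: "x - (- k) * t \<noteq> 0" for x t
      unfolding ddx DERIV_imp_deriv[OF dxx[OF nz]] DERIV_imp_deriv[OF dt] profile_equation[OF nz]
      using dxx[OF nz] real_differentiable_def by blast
    obtain x t where "z = (x, t)" by force
    then show "case z of (x, t) \<Rightarrow> deriv (\<lambda>y. \<phi> (y - (- k) * t)) differentiable (at x) \<and>
      deriv (\<lambda>t. \<phi> (x - (- k) * t)) t
        = max (deriv (deriv (\<lambda>y. \<phi> (y - (- k) * t))) x - f (\<phi> (x - (- k) * t))) 0"
      using main[of x t] z by (simp only: prod.case) (simp add: inner_prod_def)
  qed
  moreover have "(\<lambda>y. \<phi> (y - (- k) * t)) differentiable (at x)" "(\<lambda>t. \<phi> (x - (- k) * t)) differentiable (at t)" for x t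
    using dx dt real_differentiable_def by blast+
  ultimately show ?thesis
    unfolding solves_irreversible_AC_def by blast
qed

lemma C1_right:
  "\<phi> C1_differentiable_on {0<..}" "V C1_differentiable_on {0<..}"
proof -
  show "\<phi> C1_differentiable_on {0<..}"
    unfolding C1_differentiable_on_def
    using \<phi>_deriv continuous_V by (auto simp: has_real_derivative_iff_has_vector_derivative)
  have "continuous_on {0<..} (\<lambda>s. k * v s + g (u s))"
    by (intro continuous_intros trajectoryD[OF tr] continuous_on_compose2[OF continuous_g[of UNIV]]) auto
  then have "continuous_on {0<..} W"
    by (rule continuous_on_eq) (simp add: W_def)
  then show "V C1_differentiable_on {0<..}"
    unfolding C1_differentiable_on_def
    using V_deriv by (intro exI[of _ W]) (auto simp: has_real_derivative_iff_has_vector_derivative)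
qed

lemma ode_right: "0 < s \<Longrightarrow> - deriv V s + f (\<phi> s) = (- k) * V s"
  using f_\<phi>[of s] by (simp add: deriv_V W_def V_def \<phi>_def)

end

section \<open>Reduction to a globally Lipschitz nonlinearity, and conclusion\<close>

lemma C1_imp_lipschitz:
  fixes f :: "real \<Rightarrow> real"
  assumes "f C1_differentiable_on UNIV"
  obtains L where "0 \<le> L" "\<And>x y. x \<in> {a..b} \<Longrightarrow> y \<in> {a..b} \<Longrightarrow> \<bar>f x - f y\<bar> \<le> L * \<bar>x - y\<bar>"
proof -
  obtain D where D: "\<And>x. (f has_real_derivative D x) (at x)" "continuous_on UNIV D"
    using assms by (auto simp: C1_differentiable_on_def has_real_derivative_iff_has_vector_derivative)
  have "bounded (D ` {a..b})"
    by (intro compact_imp_bounded compact_continuous_image continuous_on_subset[OF D(2)]) auto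
  then obtain L where L: "0 < L" "\<And>x. x \<in> {a..b} \<Longrightarrow> \<bar>D x\<bar> \<le> L"
    unfolding bounded_pos by auto
  show thesis
  proof (rule that)
    show "\<bar>f x - f y\<bar> \<le> L * \<bar>x - y\<bar>" if "x \<in> {a..b}" "y \<in> {a..b}" for x y
      using field_differentiable_bound[of "{a..b}" f D L x y] D(1) L(2) that
      by (auto intro: has_field_derivative_at_within)
  qed (use L in simp)
qed

text \<open>\<open>g\<close> is constant to the right of \<open>a\<^sub>1\<close>; its slope \<open>- L\<close> to the left of \<open>\<alpha>\<close> keeps
  both the Lipschitz constant and the bound \<open>0 \<le> g x + L * (x - \<alpha>)\<close>.\<close>

lemma shooting_extension:
  fixes f :: "real \<Rightarrow> real"
  assumes "f C1_differentiable_on UNIV" "\<alpha> < a\<^sub>0" "a\<^sub>0 < a\<^sub>1" "f a\<^sub>0 = 0" "f a\<^sub>1 = 0"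
    and pos: "\<And>x. \<alpha> \<le> x \<Longrightarrow> x < a\<^sub>0 \<Longrightarrow> 0 < f x"
    and neg: "\<And>x. a\<^sub>0 < x \<Longrightarrow> x < a\<^sub>1 \<Longrightarrow> f x < 0"
    and int: "integral {\<alpha>..a\<^sub>1} f < 0"
  obtains g L where "shooting g \<alpha> a\<^sub>0 a\<^sub>1 L" "\<And>x. \<alpha> \<le> x \<Longrightarrow> x \<le> a\<^sub>1 \<Longrightarrow> f x = g x"
proof -
  obtain L where L: "0 \<le> L" "\<And>x y. x \<in> {\<alpha>..a\<^sub>1} \<Longrightarrow> y \<in> {\<alpha>..a\<^sub>1} \<Longrightarrow> \<bar>f x - f y\<bar> \<le> L * \<bar>x - y\<bar>"
    using C1_imp_lipschitz[OF assms(1)] by blast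
  define cl where "cl x = max \<alpha> (min a\<^sub>1 x)" for x
  define g where "g x = f (cl x) + L * max (\<alpha> - x) 0" for x
  have cl: "cl x \<in> {\<alpha>..a\<^sub>1}" for x
    using assms(2,3) by (auto simp: cl_def)
  have agree: "f x = g x" if "\<alpha> \<le> x" "x \<le> a\<^sub>1" for x
    using that by (simp add: g_def cl_def)
  have "shooting g \<alpha> a\<^sub>0 a\<^sub>1 L"
  proof
    show "\<bar>g x - g y\<bar> \<le> L * \<bar>x - y\<bar>" for x y
    proof -
      have "\<bar>g x - g y\<bar> \<le> \<bar>f (cl x) - f (cl y)\<bar> + \<bar>L * (max (\<alpha> - x) 0 - max (\<alpha> - y) 0)\<bar>"
        by (simp add: g_def algebra_simps)
      also have "\<dots> \<le> L * \<bar>cl x - cl y\<bar> + L * \<bar>max (\<alpha> - x) 0 - max (\<alpha> - y) 0\<bar>"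
        using L(2)[OF cl cl] L(1) by (simp add: abs_mult)
      also have "\<dots> = L * (\<bar>cl x - cl y\<bar> + \<bar>max (\<alpha> - x) 0 - max (\<alpha> - y) 0\<bar>)"
        by (simp add: algebra_simps)
      also have "\<dots> \<le> L * \<bar>x - y\<bar>"
      proof (rule mult_left_mono[OF _ L(1)])
        \<comment> \<open>The clamp varies only between \<alpha> and \<open>a\<^sub>1\<close>, the
          other term only to the left of \<alpha>. They never use the same stretch of the line, so
          the constant remains \<open>L\<close> and not \<open>2 * L\<close>.\<close>
        show "\<bar>cl x - cl y\<bar> + \<bar>max (\<alpha> - x) 0 - max (\<alpha> - y) 0\<bar> \<le> \<bar>x - y\<bar>"
          using assms(2,3) unfolding cl_def by linarith
      qed
      finally show ?thesis .
    qed
    show "0 < g x" if "x < a\<^sub>0" for x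
      using pos[of "cl x"] that assms(2,3) L(1)
      by (auto simp: g_def cl_def intro!: add_pos_nonneg)
    show "g x < 0" if "a\<^sub>0 < x" "x < a\<^sub>1" for x
      using neg[OF that] agree[of x] that assms(2) by simp
    show "0 \<le> g x + L * (x - \<alpha>)" for x
    proof (cases "x < \<alpha>")
      \<comment> \<open>The linear terms cancel here, leaving \<open>f \<alpha>\<close>.\<close>
      case True
      then show ?thesis
        using pos[of \<alpha>] assms(2,3) by (simp add: g_def cl_def algebra_simps)
    next
      case False
      \<comment> \<open>To the right of \<alpha>, the Lipschitz bound lets \<open>f\<close> fall
        from its positive value at \<alpha> by at most \<open>L * (x - \<alpha>)\<close>.\<close>
      have "f \<alpha> - f (cl x) \<le> L * \<bar>\<alpha> - cl x\<bar>"
        using L(2)[of \<alpha> "cl x"] cl[of x] assms(2,3) by force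
      also have "\<dots> \<le> L * (x - \<alpha>)"
        using L(1) False assms(2,3) by (intro mult_left_mono) (auto simp: cl_def)
      finally show ?thesis
        using False pos[of \<alpha>] assms(2) by (simp add: g_def)
    qed
    have "integral {\<alpha>..a\<^sub>1} g = integral {\<alpha>..a\<^sub>1} f"
      by (rule integral_cong) (simp add: agree)
    then show "integral {\<alpha>..a\<^sub>1} g < 0" using int by simp
  qed (use assms agree[of a\<^sub>0] agree[of a\<^sub>1] in auto)
  then show thesis using agree by (rule that)
qed

theorem theorem1p1:
  fixes f :: "real \<Rightarrow> real" and \<alpha> :: real
  assumes "f C1_differentiable_on UNIV"
  shows "\<exists>C\<^sub>1>0. \<exists>C\<^sub>2>0. \<forall>a_minus a_zero a_plus.
    a_minus < a_zero \<and> a_zero < a_plus \<and>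
    f a_minus = 0 \<and> f a_zero = 0 \<and> f a_plus = 0 \<and>
    deriv f a_minus > 0 \<and> deriv f a_plus > 0 \<and>
    (\<forall>z\<in>{a_minus<..<a_zero}. f z > 0) \<and> (\<forall>z\<in>{a_zero<..<a_plus}. f z < 0) \<and>
    \<alpha> \<in> {a_minus<..<a_zero} \<and> integral {\<alpha>..a_plus} f < 0
    \<longrightarrow>
    (\<exists>c \<phi>.
      solves_irreversible_AC f (\<lambda>x t. \<phi> (x - c * t)) \<and>
      solves_profile f c \<phi> \<and>
      (\<phi> \<longlongrightarrow> \<alpha>) at_bot \<and> (\<phi> \<longlongrightarrow> a_plus) at_top \<and>
      (\<forall>s. 0 \<le> deriv \<phi> s) \<and>
      (deriv \<phi> \<longlongrightarrow> 0) at_bot \<and> (deriv \<phi> \<longlongrightarrow> 0) at_top \<and>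
      W_infty 2 \<phi> \<and> L2 (deriv \<phi>) \<and> solves_obstacle_inclusion f \<alpha> c \<phi> \<and>
      (\<forall>s. \<alpha> \<le> \<phi> s \<and> \<phi> s < a_plus) \<and> (\<forall>s. 0 \<le> deriv \<phi> s \<and> deriv \<phi> s \<le> C\<^sub>1) \<and>
      - C\<^sub>2 \<le> c \<and> c < 0 \<and>
      (\<forall>s. \<phi> s > \<alpha> \<longrightarrow> deriv \<phi> s > 0) \<and>
      (\<exists>s_star.
        (\<forall>s\<le>s_star. \<phi> s = \<alpha>) \<and> (\<forall>s>s_star. \<phi> s > \<alpha>) \<and>
        \<phi> C1_differentiable_on {s_star<..} \<and> deriv \<phi> C1_differentiable_on {s_star<..} \<and>
        (\<forall>s>s_star. deriv \<phi> s > 0) \<and>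
        (\<forall>s>s_star. - deriv (deriv \<phi>) s + f (\<phi> s) = c * deriv \<phi> s)))"
  (is "\<exists>C\<^sub>1>0. \<exists>C\<^sub>2>0. \<forall>a_minus a_zero a_plus. ?hyp a_minus a_zero a_plus \<longrightarrow> ?concl C\<^sub>1 C\<^sub>2 a_plus")
proof (cases "\<exists>a_minus a_zero a_plus. ?hyp a_minus a_zero a_plus")
  case False
  \<comment> \<open>The constants are chosen before the zeros of \<open>f\<close>. If no triple is
    admissible the claim is vacuous, and 1 serves for both.\<close>
  show ?thesis
  proof (rule exI[of _ 1], rule conjI[OF zero_less_one], rule exI[of _ 1],
      rule conjI[OF zero_less_one], intro allI impI)
    fix m z p assume "?hyp m z p"
    with False show "?concl 1 1 p" by blast
  qed
next
  case True
  then obtain a_minus a_zero a_plus where hyp: "?hyp a_minus a_zero a_plus" by blast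
  have f_pos: "0 < f z" if "\<alpha> \<le> z" "z < a_zero" for z
    using hyp that by auto
  have f_neg: "f z < 0" if "a_zero < z" "z < a_plus" for z
    using hyp that by auto
  \<comment> \<open>The zeros to the right of \<open>\<alpha>\<close> are determined by \<open>f\<close> and \<open>\<alpha>\<close>, so constants found for one
    triple serve all of them.\<close>
  have unique: "q = a_plus" if "?hyp m z q" for m z q
  proof -
    have "\<not> z < a_zero" "\<not> a_zero < z"
      using that hyp f_pos[of z] bspec[of "{m<..<z}" "\<lambda>w. 0 < f w" a_zero] by auto
    then have "z = a_zero" by simp
    moreover have "\<not> q < a_plus" "\<not> a_plus < q"
      using that hyp \<open>z = a_zero\<close> f_neg[of q] bspec[of "{z<..<q}" "\<lambda>w. f w < 0" a_plus] by auto
    ultimately show ?thesis by simp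
  qed
  obtain g L where "shooting g \<alpha> a_zero a_plus L"
    and agree: "\<And>x. \<alpha> \<le> x \<Longrightarrow> x \<le> a_plus \<Longrightarrow> f x = g x"
    using shooting_extension[OF assms, of \<alpha> a_zero a_plus] f_pos f_neg hyp by auto
  then interpret shooting g \<alpha> a_zero a_plus L by simp
  obtain k u v where "0 < k" "connection k u v"
    using exists_connection by blast
  then interpret wave_profile g \<alpha> a_zero a_plus L k u v f
    by unfold_locales (use agree in auto)
  obtain C where C: "0 < C" "\<And>s. V s \<le> C" using V_bounded by blast
  \<comment> \<open>Since \<open>c = - k\<close>, the speed \<open>k\<close> itself serves as the
    second constant; the free boundary sits at 0, the starting time of the shooting.\<close>
  have concl: "?concl C k a_plus"
  proof (rule exI[of _ "- k"], rule exI[of _ \<phi>], unfold deriv_\<phi>, intro conjI allI impI)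
    show "0 < V s" if "\<alpha> < \<phi> s" for s
      using V_pos[of s] \<phi>_left[of s] that by force
    show "V s \<le> C" for s by (rule C(2))
    show "\<exists>s_star. (\<forall>s\<le>s_star. \<phi> s = \<alpha>) \<and> (\<forall>s>s_star. \<alpha> < \<phi> s) \<and>
        \<phi> C1_differentiable_on {s_star<..} \<and> V C1_differentiable_on {s_star<..} \<and>
        (\<forall>s>s_star. 0 < V s) \<and> (\<forall>s>s_star. - deriv V s + f (\<phi> s) = - k * V s)"
      by (intro exI[of _ 0] conjI allI impI \<phi>_left \<phi>_gt C1_right V_pos ode_right)
  qed (rule profile_solves_irreversible_AC profile_solves_profile profile_solves_obstacle_inclusion
      \<phi>_limits \<phi>_bounds V_nonneg V_limits W_infty_\<phi> L2_V | simp add: k)+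
  show ?thesis
  proof (rule exI[of _ C], rule conjI[OF C(1)], rule exI[of _ k], rule conjI[OF k], intro allI impI)
    fix m z q assume "?hyp m z q"
    then have "q = a_plus" by (rule unique)
    show "?concl C k q" unfolding \<open>q = a_plus\<close> by (rule concl)
  qed
qed

end
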